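(* For every odd integer $n\geq 3$, there is an infinite family of pairs of imaginary quadratic fields $\mathbb{Q}(\sqrt{d})$ and $\mathbb{Q}(\sqrt{d+1})$ with $d\in\mathbb{Z}$ whose class numbers are both divisible by $n$. *)

theory Defs
  imports Complex_Main "HOL-Computational_Algebra.Polynomial" "HOL-Algebra.Coset"
begin

text \<open>Number fields are taken as subfields of the complex numbers.\<close>

(* Closure under inverse is harmless at 0 because inverse 0 = 0. *)
definition complex_subfield :: "complex set \<Rightarrow> bool" where
  "complex_subfield K \<longleftrightarrow>
     1 \<in> K \<and> (\<forall>x\<in>K. \<forall>y\<in>K. x - y \<in> K) \<and> (\<forall>x\<in>K. \<forall>y\<in>K. x * y \<in> K) \<and>
     (\<forall>x\<in>K. inverse x \<in> K)"

(* Every subfield of the complex numbers contains the rationals, so this is Q(sqrt d). *)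
definition rat_sqrt_field :: "int \<Rightarrow> complex set" where
  "rat_sqrt_field d = complex_subfield hull {csqrt (of_int d)}"

definition rat_degree :: "complex set \<Rightarrow> nat" where
  "rat_degree K = vector_space.dim (\<lambda>(q::rat) (z::complex). of_rat q * z) K"

definition imaginary_quadratic_field :: "complex set \<Rightarrow> bool" where
  "imaginary_quadratic_field K \<longleftrightarrow> complex_subfield K \<and> rat_degree K = 2 \<and> \<not> K \<subseteq> \<real>"

definition ring_of_integers :: "complex set \<Rightarrow> complex set" where
  "ring_of_integers K = {x \<in> K. algebraic_int x}"

(* Nonzero fractional ideals; closure under negation follows from -1 being integral. *)
definition fractional_ideal :: "complex set \<Rightarrow> complex set \<Rightarrow> bool" where
  "fractional_ideal K I \<longleftrightarrow>
     I \<subseteq> K \<and> 0 \<in> I \<and> I \<noteq> {0} \<and>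
     (\<forall>x\<in>I. \<forall>y\<in>I. x + y \<in> I) \<and>
     (\<forall>a\<in>ring_of_integers K. \<forall>x\<in>I. a * x \<in> I) \<and>
     (\<exists>c\<in>ring_of_integers K. c \<noteq> 0 \<and> (\<forall>x\<in>I. c * x \<in> ring_of_integers K))"

definition ideal_mult :: "complex set \<Rightarrow> complex set \<Rightarrow> complex set" where
  "ideal_mult I J =
     {(\<Sum>i<m. x i * y i) | (m::nat) x y. (\<forall>i<m. x i \<in> I) \<and> (\<forall>i<m. y i \<in> J)}"

definition fractional_ideal_group :: "complex set \<Rightarrow> complex set monoid" where
  "fractional_ideal_group K =
     \<lparr>carrier = {I. fractional_ideal K I}, mult = ideal_mult, one = ring_of_integers K\<rparr>"

definition principal_fractional_ideals :: "complex set \<Rightarrow> complex set set" where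
  "principal_fractional_ideals K =
     {(\<lambda>a. x * a) ` ring_of_integers K | x. x \<in> K \<and> x \<noteq> 0}"

definition ideal_class_group :: "complex set \<Rightarrow> complex set set monoid" where
  "ideal_class_group K = fractional_ideal_group K Mod principal_fractional_ideals K"

definition class_number :: "complex set \<Rightarrow> nat" where
  "class_number K = Coset.order (ideal_class_group K)"

end

theory Submission
  imports Defs "HOL-Algebra.Multiplicative_Group"
begin

text \<open>Both fields have the shape \<open>\<rat>(\<surd>(1 - 4 U ^ n))\<close>: for \<open>U = 4 w ^ n - 1\<close> and
  \<open>d = - 4 U ^ n\<close>, oddness of \<open>n\<close> gives \<open>\<rat>(\<surd>d) = \<rat>(\<surd>(- U)) = \<rat>(\<surd>(1 - 4 w ^ n))\<close>, while
  \<open>d + 1 = 1 - 4 U ^ n\<close>.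

  In \<open>\<rat>(\<surd>(1 - 4 U ^ n))\<close> the integer \<open>\<alpha> = (1 + \<surd>(1 - 4 U ^ n)) / 2\<close> has trace 1 and norm
  \<open>U ^ n\<close>, so \<open>(\<alpha>) = I ^ n\<close> with \<open>I = (U, \<alpha>)\<close>. If \<open>I ^ k = (\<beta>)\<close> with \<open>n = k l\<close> and \<open>l > 1\<close>, then
  \<open>\<alpha> = \<beta> ^ l\<close> up to a sign absorbed into \<open>\<beta>\<close>. The trace \<open>a\<close> of \<open>\<beta>\<close> divides the trace 1 of
  \<open>\<beta> ^ l\<close>, so \<open>a = \<plusminus> 1\<close>, and with \<open>v = U ^ k\<close> the norm of \<open>\<beta>\<close>, the trace of \<open>\<beta> ^ l\<close> is congruent
  to \<open>a (1 - l v)\<close> modulo \<open>v\<^sup>2\<close>. Hence \<open>v\<close> divides \<open>l\<close>, which is impossible once \<open>U > n\<close>. So the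
  class of \<open>I\<close> has order exactly \<open>n\<close>.

  Two such fields for \<open>w\<close> and \<open>w'\<close> with \<open>w\<close> even and \<open>m = 2 w ^ n - 1\<close> dividing \<open>w'\<close> differ: if they
  were equal, \<open>(1 - 4 w ^ n) (1 - 4 w' ^ n)\<close> would be a square, but it is congruent to \<open>-1\<close> modulo
  \<open>m\<close>, and \<open>m\<close> is congruent to 3 modulo 4.\<close>

section \<open>Rational integers and algebraic integers\<close>

text \<open>For r = a / b in lowest terms, every power of b divides the fixed integer c, which
  forces b = 1.\<close>

lemma rat_bounded_power_denominators_int:
  fixes r :: real and c :: int
  assumes r: "r \<in> \<rat>" and c: "c > 0" and den: "\<And>k::nat. of_int c * r ^ k \<in> \<int>"
  shows "r \<in> \<int>"
proof -
  obtain a b :: int where ab: "b > 0" "Rings.coprime a b" "r = of_int a / of_int b"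
    using r by (auto elim: Rats_cases')
  have dvd: "b ^ k dvd c" for k
  proof -
    obtain m where m: "of_int c * r ^ k = (of_int m :: real)"
      using den[of k] by (auto elim: Ints_cases)
    have "(of_int (c * a ^ k) :: real) = of_int (m * b ^ k)"
      using m ab(1) by (simp add: ab(3) power_divide field_simps)
    hence "c * a ^ k = m * b ^ k"
      by (simp only: of_int_eq_iff)
    hence "b ^ k dvd c * a ^ k" by simp
    moreover have "Rings.coprime (b ^ k) (a ^ k)"
      using ab(2) by (simp add: coprime_commute)
    ultimately show ?thesis
      by (simp add: coprime_dvd_mult_left_iff)
  qed
  have "b = 1"
  proof (rule ccontr)
    assume "b \<noteq> 1"
    with ab(1) have "b \<ge> 2" by simp
    \<comment> \<open>The exponent c is large enough, because 2^c > c.\<close>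
    hence "(2::int) ^ nat c \<le> b ^ nat c" by (intro power_mono) auto
    also have "\<dots> \<le> c" using dvd c by (intro zdvd_imp_le) auto
    finally have "2 ^ nat c \<le> c" .
    moreover have "int (nat c) < int (2 ^ nat c)"
      by (simp only: of_nat_less_iff) (rule less_exp)
    ultimately show False using c by simp
  qed
  thus ?thesis using ab by simp
qed

lemma rat_sqr_int_imp_int:
  fixes r :: real
  assumes "r \<in> \<rat>" "r ^ 2 \<in> \<int>"
  shows "r \<in> \<int>"
proof (rule rational_algebraic_int_is_int[OF _ assms(1)])
  show "algebraic_int r"
    by (rule algebraic_int_root[of "r ^ 2" "Polynomial.monom 1 2"])
      (use assms in \<open>auto simp: poly_monom degree_monom_eq int_imp_algebraic_int\<close>)
qed

lemma Rats_common_denominator: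
  fixes S :: "real set"
  assumes "finite S" "S \<subseteq> \<rat>"
  shows "\<exists>c::int. c > 0 \<and> (\<forall>r\<in>S. of_int c * r \<in> \<int>)"
  using assms
proof (induction rule: finite_induct)
  case empty
  show ?case by (intro exI[of _ 1]) auto
next
  case (insert r S)
  then obtain c :: int where c: "c > 0" "\<forall>r\<in>S. of_int c * r \<in> \<int>" by auto
  obtain a b :: int where ab: "b > 0" "r = of_int a / of_int b"
    using insert.prems by (auto elim: Rats_cases')
  have "of_int (c * b) * r \<in> \<int>"
    using ab by simp
  moreover have "of_int (c * b) * s \<in> \<int>" if "s \<in> S" for s
  proof -
    have "of_int b * (of_int c * s) \<in> \<int>" by (rule Ints_mult) (auto intro: c(2)[rule_format, OF that])
    thus ?thesis by (simp add: mult_ac)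
  qed
  ultimately show ?case
    using c(1) ab(1) by (intro exI[of _ "c * b"]) auto
qed

text \<open>The monic integral equation of x makes the moments
  \<open>R i j = Re (x ^ i * cnj x ^ j)\<close> obey an integral linear recursion in each index. A
  common denominator of the finitely many moments with i, j < m therefore serves for all of them.
  The diagonal moments are the powers of |x|^2, which thus have bounded denominators.\<close>

lemma algebraic_int_norm_sqr_int:
  fixes x :: complex
  assumes int: "algebraic_int x" and rat: "\<And>i j. Re (x ^ i * cnj x ^ j) \<in> \<rat>"
  shows "(cmod x)\<^sup>2 \<in> \<int>"
proof -
  obtain p where p: "lead_coeff p = 1" "\<forall>i. Polynomial.coeff p i \<in> \<int>" "poly p x = 0"
    using int by (auto elim: algebraic_int.cases)
  define m where "m = degree p"
  obtain a :: "nat \<Rightarrow> int" where a: "\<And>i. Polynomial.coeff p i = of_int (a i)"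
  proof -
    have "\<forall>i. \<exists>z::int. Polynomial.coeff p i = of_int z" using p(2) by (auto elim: Ints_cases)
    thus ?thesis using that by metis
  qed
  have xm: "x ^ m = - (\<Sum>i<m. of_int (a i) * x ^ i)"
  proof -
    have "0 = (\<Sum>i\<le>m. Polynomial.coeff p i * x ^ i)" using p(3) by (simp add: poly_altdef m_def)
    also have "\<dots> = (\<Sum>i<m. of_int (a i) * x ^ i) + x ^ m"
      using p(1) by (simp add: a m_def lessThan_Suc_atMost[symmetric])
    finally show ?thesis by (simp add: eq_neg_iff_add_eq_0 add.commute)
  qed
  define R where "R = (\<lambda>i j. Re (x ^ i * cnj x ^ j))"
  have R_sym: "R i j = R j i" for i j
  proof -
    have "R i j = Re (cnj (x ^ i * cnj x ^ j))" unfolding R_def by (simp only: complex_cnj cnj.sel)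
    thus ?thesis by (simp add: R_def mult.commute)
  qed
  have R_rec: "R (i + m) j = - (\<Sum>k<m. of_int (a k) * R (i + k) j)" for i j
  proof -
    have "x ^ (i + m) * cnj x ^ j = - (\<Sum>k<m. of_int (a k) * (x ^ (i + k) * cnj x ^ j))"
      by (simp add: power_add xm sum_distrib_left sum_distrib_right mult_ac)
    hence "R (i + m) j = - (\<Sum>k<m. Re (of_int (a k) * (x ^ (i + k) * cnj x ^ j)))"
      unfolding R_def by (simp only: Re_sum uminus_complex.sel)
    also have "\<dots> = - (\<Sum>k<m. of_int (a k) * R (i + k) j)"
      unfolding R_def by (intro arg_cong[of _ _ uminus] sum.cong) auto
    finally show ?thesis .
  qed
  obtain c :: int where c: "c > 0" "\<And>i j. i < m \<Longrightarrow> j < m \<Longrightarrow> of_int c * R i j \<in> \<int>"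
    using Rats_common_denominator[of "(\<lambda>(i, j). R i j) ` ({..<m} \<times> {..<m})"] rat
    by (fastforce simp: R_def)
  have step: "of_int c * R i j \<in> \<int>" if j: "\<And>i. i < m \<Longrightarrow> of_int c * R i j \<in> \<int>" for i j
  proof (induction i rule: less_induct)
    case (less i)
    show ?case
    proof (cases "i < m")
      case False
      then obtain l where l: "i = l + m" by (metis le_add_diff_inverse2 not_less)
      have "of_int c * R i j = - (\<Sum>k<m. of_int (a k) * (of_int c * R (l + k) j))"
        by (simp add: l R_rec sum_distrib_left mult_ac)
      also have "\<dots> \<in> \<int>"
        by (intro Ints_minus Ints_sum Ints_mult less) (auto simp: l)
      finally show ?thesis .
    qed (use j in auto)
  qed
  \<comment> \<open>\<open>step\<close> reduces the first index. Its hypothesis, where the second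
    index is still arbitrary, is \<open>step\<close> again, read through the symmetry of
    \<open>R\<close>.\<close>
  have "of_int c * R i j \<in> \<int>" for i j
  proof (rule step)
    fix k assume "k < m"
    have "of_int c * R j k \<in> \<int>" by (rule step) (use c \<open>k < m\<close> in auto)
    thus "of_int c * R k j \<in> \<int>" by (simp add: R_sym)
  qed
  moreover have R_diag: "R k k = ((cmod x)\<^sup>2) ^ k" for k
  proof -
    have "x ^ k * cnj x ^ k = of_real (((cmod x)\<^sup>2) ^ k)"
      by (simp only: power_mult_distrib[symmetric] complex_norm_square[symmetric] of_real_power)
    thus ?thesis by (simp only: R_def Re_complex_of_real)
  qed
  ultimately have "of_int c * ((cmod x)\<^sup>2) ^ k \<in> \<int>" for k by metis
  moreover have "(cmod x)\<^sup>2 \<in> \<rat>" using rat[of 1 1] R_diag[of 1] by (simp add: R_def)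
  ultimately show ?thesis using c(1) rat_bounded_power_denominators_int by blast
qed

section \<open>Subfields of the complex numbers, and integrality by trace and norm\<close>

locale subfield_of_complex =
  fixes K :: "complex set"
  assumes subfield: "complex_subfield K"
begin

lemma one_in [simp]: "1 \<in> K"
  and diff_in: "x \<in> K \<Longrightarrow> y \<in> K \<Longrightarrow> x - y \<in> K"
  and mult_in: "x \<in> K \<Longrightarrow> y \<in> K \<Longrightarrow> x * y \<in> K"
  and inverse_in: "x \<in> K \<Longrightarrow> inverse x \<in> K"
  using subfield by (auto simp: complex_subfield_def)

lemma zero_in [simp]: "0 \<in> K"
  using diff_in[of 1 1] by simp

lemma uminus_in: "x \<in> K \<Longrightarrow> - x \<in> K"
  using diff_in[of 0 x] by simp

lemma add_in: "x \<in> K \<Longrightarrow> y \<in> K \<Longrightarrow> x + y \<in> K"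
  using diff_in[of x "- y"] uminus_in[of y] by simp

lemma divide_in: "x \<in> K \<Longrightarrow> y \<in> K \<Longrightarrow> x / y \<in> K"
  using mult_in[of x "inverse y"] inverse_in[of y] by (simp add: divide_inverse)

lemma power_in: "x \<in> K \<Longrightarrow> x ^ k \<in> K"
  by (induction k) (auto intro: mult_in)

lemma of_nat_in: "of_nat k \<in> K"
  by (induction k) (auto intro: add_in)

lemma of_int_in: "of_int k \<in> K"
proof (cases "k \<ge> 0")
  case True
  thus ?thesis using of_nat_in[of "nat k"] by simp
next
  case False
  thus ?thesis using uminus_in[OF of_nat_in[of "nat (- k)"]] by simp
qed

lemma Rats_in: "x \<in> \<rat> \<Longrightarrow> x \<in> K"
  by (elim Rats_cases') (simp add: divide_in of_int_in)

end

text \<open>The two conditions make the trace \<open>2 * Re x\<close> and the norm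
  \<open>x * cnj x\<close> rational, which is the form in which the arithmetic below uses that a
  field is imaginary quadratic. The rationals satisfy them as well.\<close>

locale imaginary_field = subfield_of_complex +
  assumes cnj_closed: "x \<in> K \<Longrightarrow> cnj x \<in> K"
    and Re_rat: "x \<in> K \<Longrightarrow> Re x \<in> \<rat>"
begin

text \<open>The norms of x and of x + 1 are integers, and |x + 1|^2 - |x|^2 - 1 is the trace of x.
  Conversely, x is a root of X^2 - 2 Re(x) X + |x|^2.\<close>

lemma integer_iff:
  "x \<in> ring_of_integers K \<longleftrightarrow> x \<in> K \<and> 2 * Re x \<in> \<int> \<and> (cmod x)\<^sup>2 \<in> \<int>"
proof
  assume x: "x \<in> ring_of_integers K"
  hence xK: "x \<in> K" and int: "algebraic_int x" by (auto simp: ring_of_integers_def)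
  have norm: "(cmod y)\<^sup>2 \<in> \<int>" if "y \<in> K" "algebraic_int y" for y
    using that by (intro algebraic_int_norm_sqr_int Re_rat mult_in power_in cnj_closed) auto
  have "algebraic_int (x + 1)"
    by (rule algebraic_int_root[OF int, of "[:-1, 1:]"])
      (auto simp: coeff_pCons split: nat.splits)
  hence "(cmod (x + 1))\<^sup>2 \<in> \<int>" using xK by (intro norm add_in) auto
  hence "(cmod (x + 1))\<^sup>2 - (cmod x)\<^sup>2 - 1 \<in> \<int>" using norm[OF xK int] by simp
  also have "(cmod (x + 1))\<^sup>2 - (cmod x)\<^sup>2 - 1 = 2 * Re x"
    unfolding cmod_power2 by (simp add: power2_eq_square algebra_simps)
  finally show "x \<in> K \<and> 2 * Re x \<in> \<int> \<and> (cmod x)\<^sup>2 \<in> \<int>" using norm[OF xK int] xK by simp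
next
  assume x: "x \<in> K \<and> 2 * Re x \<in> \<int> \<and> (cmod x)\<^sup>2 \<in> \<int>"
  have "algebraic_int x"
  proof
    show "poly [:of_real ((cmod x)\<^sup>2), - of_real (2 * Re x), 1:] x = 0"
      unfolding cmod_power2 by (simp add: complex_eq_iff power2_eq_square algebra_simps)
    have "complex_of_real ((cmod x)\<^sup>2) \<in> \<int>" "complex_of_real (2 * Re x) \<in> \<int>"
      using x by (metis Ints_cases Ints_of_int of_real_of_int_eq)+
    thus "\<forall>i. Polynomial.coeff [:of_real ((cmod x)\<^sup>2), - of_real (2 * Re x), 1:] i \<in> (\<int> :: complex set)"
      by (auto simp: coeff_pCons simp del: of_real_mult of_real_power split: nat.splits)
  qed auto
  thus "x \<in> ring_of_integers K" using x by (auto simp: ring_of_integers_def)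
qed

lemma integer_in: "x \<in> ring_of_integers K \<Longrightarrow> x \<in> K"
  by (simp add: integer_iff)

lemma integer_trace: "x \<in> ring_of_integers K \<Longrightarrow> 2 * Re x \<in> \<int>"
  by (simp add: integer_iff)

lemma integer_norm: "x \<in> ring_of_integers K \<Longrightarrow> (cmod x)\<^sup>2 \<in> \<int>"
  by (simp add: integer_iff)

lemma integer_cnj: "x \<in> ring_of_integers K \<Longrightarrow> cnj x \<in> ring_of_integers K"
  by (simp add: integer_iff cnj_closed)

text \<open>This is the cross term of |x + y|^2 and, with cnj y in place of y, the trace of x y, so
  closure under sums and products both rest on it. Twice the value is a b + e, where a and b are the
  traces and e = 4 Im x Im y. Here e is rational with integral square, hence an integer, and e^2 and
  (a b)^2 agree modulo 2, so a b + e is even.\<close>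

lemma integer_trace_mult_cnj:
  assumes x: "x \<in> ring_of_integers K" and y: "y \<in> ring_of_integers K"
  shows "2 * Re (x * cnj y) \<in> \<int>"
proof -
  obtain a b :: int where ab: "2 * Re x = of_int a" "2 * Re y = of_int b"
    using x y by (auto simp: integer_iff elim!: Ints_cases)
  obtain M N :: int where MN: "(cmod x)\<^sup>2 = of_int M" "(cmod y)\<^sup>2 = of_int N"
    using x y by (auto simp: integer_iff elim!: Ints_cases)
  define e where "e = 4 * Im x * Im y"
  have "4 * Re (x * cnj y) - 4 * Re x * Re y \<in> \<rat>"
    using x y by (intro Rats_diff Rats_mult Re_rat mult_in cnj_closed) (auto simp: integer_in)
  hence "e \<in> \<rat>" by (simp add: e_def algebra_simps)
  have im: "4 * (Im x)\<^sup>2 = of_int (4 * M - a\<^sup>2)" "4 * (Im y)\<^sup>2 = of_int (4 * N - b\<^sup>2)"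
  proof -
    have "(of_int a)\<^sup>2 + 4 * (Im x)\<^sup>2 = 4 * real_of_int M"
      unfolding MN(1)[symmetric] ab(1)[symmetric] cmod_power2 by (simp add: power_mult_distrib)
    thus "4 * (Im x)\<^sup>2 = of_int (4 * M - a\<^sup>2)" by simp
    have "(of_int b)\<^sup>2 + 4 * (Im y)\<^sup>2 = 4 * real_of_int N"
      unfolding MN(2)[symmetric] ab(2)[symmetric] cmod_power2 by (simp add: power_mult_distrib)
    thus "4 * (Im y)\<^sup>2 = of_int (4 * N - b\<^sup>2)" by simp
  qed
  have e2: "e\<^sup>2 = of_int ((4 * M - a\<^sup>2) * (4 * N - b\<^sup>2))"
    unfolding of_int_mult im[symmetric] by (simp add: e_def power2_eq_square)
  have "e \<in> \<int>" using \<open>e \<in> \<rat>\<close> by (rule rat_sqr_int_imp_int) (simp only: e2 Ints_of_int)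
  then obtain f :: int where f: "e = of_int f" by (auto elim: Ints_cases)
  have "f\<^sup>2 = (4 * M - a\<^sup>2) * (4 * N - b\<^sup>2)"
    using e2 unfolding f by (simp only: of_int_power[symmetric] of_int_eq_iff)
  hence "f\<^sup>2 + (a * b)\<^sup>2 = 2 * (8 * M * N - 2 * M * b\<^sup>2 - 2 * N * a\<^sup>2 + (a * b)\<^sup>2)"
    by (simp add: algebra_simps power_mult_distrib)
  hence "even (f\<^sup>2 + (a * b)\<^sup>2)" by simp
  hence "even (a * b + f)" by simp
  then obtain g where g: "a * b + f = 2 * g" by (elim evenE)
  have "2 * (2 * Re (x * cnj y)) = (2 * Re x) * (2 * Re y) + e"
    by (simp add: e_def algebra_simps)
  also have "\<dots> = of_int (a * b + f)" by (simp only: ab f of_int_mult of_int_add)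
  also have "\<dots> = 2 * of_int g" by (simp only: g of_int_mult of_int_numeral)
  finally have "2 * Re (x * cnj y) = of_int g" by linarith
  thus ?thesis by (simp only: Ints_of_int)
qed

lemma integer_add:
  assumes x: "x \<in> ring_of_integers K" and y: "y \<in> ring_of_integers K"
  shows "x + y \<in> ring_of_integers K"
proof -
  have "(cmod (x + y))\<^sup>2 = (cmod x)\<^sup>2 + (cmod y)\<^sup>2 + 2 * Re (x * cnj y)"
    unfolding cmod_power2 by (simp add: power2_eq_square algebra_simps)
  hence "(cmod (x + y))\<^sup>2 \<in> \<int>"
    using integer_norm[OF x] integer_norm[OF y] integer_trace_mult_cnj[OF x y] by simp
  moreover have "2 * Re (x + y) \<in> \<int>"
    using integer_trace[OF x] integer_trace[OF y] by (simp add: distrib_left)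
  ultimately show ?thesis using x y by (auto simp: integer_iff add_in)
qed

lemma integer_mult:
  assumes x: "x \<in> ring_of_integers K" and y: "y \<in> ring_of_integers K"
  shows "x * y \<in> ring_of_integers K"
  using integer_trace_mult_cnj[OF x integer_cnj[OF y]] integer_norm[OF x] integer_norm[OF y] x y
  by (auto simp: integer_iff mult_in norm_mult power_mult_distrib)

lemma integer_of_int: "of_int k \<in> ring_of_integers K"
  by (simp add: ring_of_integers_def of_int_in)

lemma integer_0 [simp]: "0 \<in> ring_of_integers K"
  using integer_of_int[of 0] by simp

lemma integer_1 [simp]: "1 \<in> ring_of_integers K"
  using integer_of_int[of 1] by simp

lemma integer_power: "x \<in> ring_of_integers K \<Longrightarrow> x ^ k \<in> ring_of_integers K"
  by (induction k) (auto intro: integer_mult)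

end

section \<open>The group of fractional ideals\<close>

lemma ideal_multI: "x \<in> I \<Longrightarrow> y \<in> J \<Longrightarrow> x * y \<in> ideal_mult I J"
  unfolding ideal_mult_def
  by (rule CollectI, rule exI[of _ 1], rule exI[of _ "\<lambda>_. x"], rule exI[of _ "\<lambda>_. y"]) auto

lemma zero_in_ideal_mult: "0 \<in> ideal_mult I J"
  unfolding ideal_mult_def by (rule CollectI, rule exI[of _ 0]) auto

lemma ideal_mult_add:
  assumes "a \<in> ideal_mult I J" "b \<in> ideal_mult I J"
  shows "a + b \<in> ideal_mult I J"
proof -
  obtain m :: nat and x y where a: "a = (\<Sum>i<m. x i * y i)" "\<forall>i<m. x i \<in> I" "\<forall>i<m. y i \<in> J"
    using assms(1) unfolding ideal_mult_def by blast
  obtain k :: nat and u v where b: "b = (\<Sum>i<k. u i * v i)" "\<forall>i<k. u i \<in> I" "\<forall>i<k. v i \<in> J"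
    using assms(2) unfolding ideal_mult_def by blast
  define X where "X = (\<lambda>i. if i < m then x i else u (i - m))"
  define Y where "Y = (\<lambda>i. if i < m then y i else v (i - m))"
  have "(\<Sum>i<m + k. X i * Y i) = (\<Sum>i<m. X i * Y i) + (\<Sum>i<k. X (m + i) * Y (m + i))"
    by (induction k) (auto simp: add.assoc)
  also have "\<dots> = a + b" by (simp add: a b X_def Y_def)
  finally have "a + b = (\<Sum>i<m + k. X i * Y i)" ..
  moreover have "\<forall>i<m + k. X i \<in> I" "\<forall>i<m + k. Y i \<in> J" using a b by (auto simp: X_def Y_def)
  ultimately show ?thesis unfolding ideal_mult_def by blast
qed

lemma ideal_mult_induct [consumes 1, case_names zero add prod]:
  assumes a: "a \<in> ideal_mult I J" and zero: "P 0"
    and add: "\<And>a b. P a \<Longrightarrow> P b \<Longrightarrow> P (a + b)"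
    and prod: "\<And>x y. x \<in> I \<Longrightarrow> y \<in> J \<Longrightarrow> P (x * y)"
  shows "P a"
proof -
  obtain m :: nat and x y where *: "a = (\<Sum>i<m. x i * y i)" "\<forall>i<m. x i \<in> I" "\<forall>i<m. y i \<in> J"
    using a unfolding ideal_mult_def by blast
  have "P (\<Sum>i<k. x i * y i)" if "k \<le> m" for k
    using that by (induction k) (use * in \<open>auto intro!: zero add prod\<close>)
  thus ?thesis using * by simp
qed

lemma ideal_mult_commute: "ideal_mult I J = ideal_mult J I"
proof -
  have "ideal_mult I J \<subseteq> ideal_mult J I" for I J
  proof
    fix a assume "a \<in> ideal_mult I J"
    thus "a \<in> ideal_mult J I"
    proof (induction rule: ideal_mult_induct)
      case (prod x y)
      thus ?case using ideal_multI[of y J x I] by (simp add: mult.commute)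
    qed (auto intro: zero_in_ideal_mult ideal_mult_add)
  qed
  thus ?thesis by blast
qed

lemma ideal_mult_assoc: "ideal_mult (ideal_mult I J) L = ideal_mult I (ideal_mult J L)"
proof -
  have sub: "ideal_mult (ideal_mult I J) L \<subseteq> ideal_mult I (ideal_mult J L)" for I J L
  proof
    fix a assume "a \<in> ideal_mult (ideal_mult I J) L"
    thus "a \<in> ideal_mult I (ideal_mult J L)"
    proof (induction rule: ideal_mult_induct)
      case (prod x z)
      from prod(1) show ?case
      proof (induction rule: ideal_mult_induct)
        case zero
        show ?case by (simp add: zero_in_ideal_mult)
      next
        case (add a b)
        thus ?case by (simp add: distrib_right ideal_mult_add)
      next
        case (prod x y)
        thus ?case using \<open>z \<in> L\<close> by (simp add: mult.assoc ideal_multI)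
      qed
    qed (auto intro: zero_in_ideal_mult ideal_mult_add)
  qed
  \<comment> \<open>Commuting the factors turns \<open>sub\<close> into the reverse
    inclusion.\<close>
  have "ideal_mult I (ideal_mult J L) = ideal_mult (ideal_mult L J) I"
    by (simp add: ideal_mult_commute)
  also have "\<dots> \<subseteq> ideal_mult L (ideal_mult J I)" by (rule sub)
  also have "\<dots> = ideal_mult (ideal_mult I J) L" by (simp add: ideal_mult_commute)
  finally show ?thesis using sub by blast
qed

lemma
  assumes "fractional_ideal K I"
  shows fractional_ideal_subset: "x \<in> I \<Longrightarrow> x \<in> K"
    and fractional_ideal_zero: "0 \<in> I"
    and fractional_ideal_add: "x \<in> I \<Longrightarrow> y \<in> I \<Longrightarrow> x + y \<in> I"
    and fractional_ideal_smult: "a \<in> ring_of_integers K \<Longrightarrow> x \<in> I \<Longrightarrow> a * x \<in> I"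
    and fractional_ideal_nonzeroE: "(\<And>x. x \<in> I \<Longrightarrow> x \<noteq> 0 \<Longrightarrow> P) \<Longrightarrow> P"
    and fractional_ideal_denominatorE:
      "(\<And>c. c \<in> ring_of_integers K \<Longrightarrow> c \<noteq> 0 \<Longrightarrow> (\<And>x. x \<in> I \<Longrightarrow> c * x \<in> ring_of_integers K) \<Longrightarrow> P) \<Longrightarrow> P"
  using assms unfolding fractional_ideal_def by blast+

lemma ideal_mult_unit:
  assumes "fractional_ideal K I" "1 \<in> ring_of_integers K"
  shows "ideal_mult (ring_of_integers K) I = I"
proof
  show "ideal_mult (ring_of_integers K) I \<subseteq> I"
  proof
    fix a assume "a \<in> ideal_mult (ring_of_integers K) I"
    thus "a \<in> I"
      by (induction rule: ideal_mult_induct)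
        (use assms in \<open>auto intro: fractional_ideal_zero fractional_ideal_add fractional_ideal_smult\<close>)
  qed
  show "I \<subseteq> ideal_mult (ring_of_integers K) I"
    using ideal_multI[OF assms(2), of _ I] by auto
qed

section \<open>Inverses of fractional ideals and the group they form\<close>

context imaginary_field
begin

abbreviation principal :: "complex \<Rightarrow> complex set" where
  "principal x \<equiv> (\<lambda>a. x * a) ` ring_of_integers K"

lemma principal_self: "x \<in> principal x"
  using integer_1 by (metis image_eqI mult.right_neutral)

text \<open>A common denominator c of trace and norm suffices, since scaling x by c multiplies the
  trace by c and the norm by c^2.\<close>

lemma ex_denominator:
  assumes "x \<in> K"
  shows "\<exists>c\<in>ring_of_integers K. c \<noteq> 0 \<and> c * x \<in> ring_of_integers K"
proof -
  have "Re (x * cnj x) \<in> \<rat>" using assms by (intro Re_rat mult_in cnj_closed)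
  hence "(cmod x)\<^sup>2 \<in> \<rat>" by (simp add: complex_norm_square[symmetric] cmod_power2 power2_eq_square)
  then obtain c :: int where c: "c > 0" "of_int c * (2 * Re x) \<in> \<int>" "of_int c * (cmod x)\<^sup>2 \<in> \<int>"
    using Rats_common_denominator[of "{2 * Re x, (cmod x)\<^sup>2}"] Re_rat[OF assms] by auto
  have "(cmod (of_int c * x))\<^sup>2 = of_int c * (of_int c * (cmod x)\<^sup>2)"
    by (simp add: norm_mult power_mult_distrib) (simp add: power2_eq_square)
  hence "(cmod (of_int c * x))\<^sup>2 \<in> \<int>" using c(3) by simp
  moreover have "2 * Re (of_int c * x) \<in> \<int>" using c(2) by (simp add: mult_ac)
  ultimately have "of_int c * x \<in> ring_of_integers K"
    using assms by (auto simp: integer_iff mult_in of_int_in)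
  thus ?thesis using c(1) by (intro bexI[of _ "of_int c"]) (auto simp: integer_of_int)
qed

lemma fractional_ideal_principal:
  assumes x: "x \<in> K" "x \<noteq> 0"
  shows "fractional_ideal K (principal x)"
  unfolding fractional_ideal_def
proof (intro conjI ballI)
  show "principal x \<subseteq> K" using x by (auto intro: mult_in integer_in)
  show "0 \<in> principal x" using integer_0 by (metis image_eqI mult_zero_right)
  show "principal x \<noteq> {0}" using principal_self[of x] x(2) by blast
  show "a + b \<in> principal x" if "a \<in> principal x" "b \<in> principal x" for a b
  proof -
    obtain u v where "a = x * u" "b = x * v" "u \<in> ring_of_integers K" "v \<in> ring_of_integers K"
      using \<open>a \<in> _\<close> \<open>b \<in> _\<close> by auto
    thus ?thesis by (intro image_eqI[of _ _ "u + v"]) (auto simp: distrib_left integer_add)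
  qed
  show "r * a \<in> principal x" if "r \<in> ring_of_integers K" "a \<in> principal x" for r a
  proof -
    obtain u where "a = x * u" "u \<in> ring_of_integers K" using \<open>a \<in> _\<close> by auto
    thus ?thesis using \<open>r \<in> _\<close> by (intro image_eqI[of _ _ "r * u"]) (auto simp: mult_ac integer_mult)
  qed
  show "\<exists>c\<in>ring_of_integers K. c \<noteq> 0 \<and> (\<forall>a\<in>principal x. c * a \<in> ring_of_integers K)"
  proof -
    obtain c where c: "c \<in> ring_of_integers K" "c \<noteq> 0" "c * x \<in> ring_of_integers K"
      using ex_denominator[OF x(1)] by blast
    have "c * (x * u) \<in> ring_of_integers K" if "u \<in> ring_of_integers K" for u
      using integer_mult[OF c(3) that] by (simp add: mult.assoc)
    thus ?thesis using c by blast
  qed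
qed

lemma ideal_mult_principal:
  assumes "x \<in> K" "y \<in> K" "x \<noteq> 0" "y \<noteq> 0"
  shows "ideal_mult (principal x) (principal y) = principal (x * y)"
proof
  show "ideal_mult (principal x) (principal y) \<subseteq> principal (x * y)"
  proof
    fix a assume "a \<in> ideal_mult (principal x) (principal y)"
    moreover have I: "fractional_ideal K (principal (x * y))"
      using assms by (intro fractional_ideal_principal mult_in) auto
    ultimately show "a \<in> principal (x * y)"
    proof (induction rule: ideal_mult_induct)
      case (prod a b)
      then obtain u v where "a = x * u" "b = y * v" "u \<in> ring_of_integers K" "v \<in> ring_of_integers K"
        by auto
      thus ?case by (intro image_eqI[of _ _ "u * v"]) (auto simp: mult_ac integer_mult)
    qed (auto intro: fractional_ideal_zero[OF I] fractional_ideal_add[OF I])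
  qed
  show "principal (x * y) \<subseteq> ideal_mult (principal x) (principal y)"
  proof
    fix a assume "a \<in> principal (x * y)"
    then obtain u where "a = x * (y * u)" "u \<in> ring_of_integers K" by (auto simp: mult.assoc)
    thus "a \<in> ideal_mult (principal x) (principal y)"
      by (auto intro!: ideal_multI principal_self)
  qed
qed

lemma fractional_ideal_mult:
  assumes I: "fractional_ideal K I" and J: "fractional_ideal K J"
  shows "fractional_ideal K (ideal_mult I J)"
  unfolding fractional_ideal_def
proof (intro conjI ballI)
  show "ideal_mult I J \<subseteq> K"
  proof
    fix a assume "a \<in> ideal_mult I J"
    thus "a \<in> K" by (induction rule: ideal_mult_induct)
        (use fractional_ideal_subset[OF I] fractional_ideal_subset[OF J] in \<open>auto intro: add_in mult_in\<close>)
  qed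
  show "0 \<in> ideal_mult I J" by (rule zero_in_ideal_mult)
  show "ideal_mult I J \<noteq> {0}"
  proof -
    obtain x y where "x \<in> I" "x \<noteq> 0" "y \<in> J" "y \<noteq> 0"
      using fractional_ideal_nonzeroE[OF I] fractional_ideal_nonzeroE[OF J] by metis
    hence "x * y \<in> ideal_mult I J" "x * y \<noteq> 0" by (auto intro: ideal_multI)
    thus ?thesis by blast
  qed
  show "a + b \<in> ideal_mult I J" if "a \<in> ideal_mult I J" "b \<in> ideal_mult I J" for a b
    using that by (rule ideal_mult_add)
  show "r * a \<in> ideal_mult I J" if r: "r \<in> ring_of_integers K" and "a \<in> ideal_mult I J" for r a
    using that(2)
  proof (induction rule: ideal_mult_induct)
    case (prod x y)
    thus ?case using ideal_multI[OF fractional_ideal_smult[OF I r], of x y J]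
      by (simp add: mult.assoc)
  qed (auto simp: distrib_left intro: zero_in_ideal_mult ideal_mult_add)
  show "\<exists>c\<in>ring_of_integers K. c \<noteq> 0 \<and> (\<forall>a\<in>ideal_mult I J. c * a \<in> ring_of_integers K)"
  proof -
    obtain c where c: "c \<in> ring_of_integers K" "c \<noteq> 0" "\<And>x. x \<in> I \<Longrightarrow> c * x \<in> ring_of_integers K"
      using fractional_ideal_denominatorE[OF I] by metis
    obtain d where d: "d \<in> ring_of_integers K" "d \<noteq> 0" "\<And>x. x \<in> J \<Longrightarrow> d * x \<in> ring_of_integers K"
      using fractional_ideal_denominatorE[OF J] by metis
    have "c * d * a \<in> ring_of_integers K" if "a \<in> ideal_mult I J" for a
      using that
    proof (induction rule: ideal_mult_induct)
      case (prod x y)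
      thus ?case using integer_mult[OF c(3) d(3), of x y] by (simp add: mult_ac)
    qed (auto simp: distrib_left intro: integer_add)
    thus ?thesis using c d by (intro bexI[of _ "c * d"]) (auto intro: integer_mult)
  qed
qed

text \<open>Up to a scalar, the inverse of an ideal is its conjugate; this makes the candidates for
  the inverse available.\<close>

lemma fractional_ideal_scaled_cnj:
  assumes I: "fractional_ideal K I" and c: "c \<in> K" "c \<noteq> 0"
  shows "fractional_ideal K ((\<lambda>x. c * cnj x) ` I)" (is "fractional_ideal K ?J")
  unfolding fractional_ideal_def
proof (intro conjI ballI)
  show "?J \<subseteq> K" using c fractional_ideal_subset[OF I] by (auto intro: mult_in cnj_closed)
  show "0 \<in> ?J" using fractional_ideal_zero[OF I] by (intro image_eqI[of _ _ 0]) auto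
  show "?J \<noteq> {0}"
  proof -
    obtain x where "x \<in> I" "x \<noteq> 0" using fractional_ideal_nonzeroE[OF I] by metis
    hence "c * cnj x \<in> ?J" "c * cnj x \<noteq> 0" using c by auto
    thus ?thesis by blast
  qed
  show "a + b \<in> ?J" if "a \<in> ?J" "b \<in> ?J" for a b
  proof -
    obtain u v where "a = c * cnj u" "b = c * cnj v" "u \<in> I" "v \<in> I"
      using \<open>a \<in> _\<close> \<open>b \<in> _\<close> by auto
    thus ?thesis using fractional_ideal_add[OF I, of u v]
      by (intro image_eqI[of _ _ "u + v"]) (auto simp: distrib_left)
  qed
  show "r * a \<in> ?J" if "r \<in> ring_of_integers K" "a \<in> ?J" for r a
  proof -
    obtain u where "a = c * cnj u" "u \<in> I" using \<open>a \<in> _\<close> by auto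
    thus ?thesis using fractional_ideal_smult[OF I integer_cnj[OF that(1)], of u]
      by (intro image_eqI[of _ _ "cnj r * u"]) (auto simp: mult_ac)
  qed
  show "\<exists>r\<in>ring_of_integers K. r \<noteq> 0 \<and> (\<forall>a\<in>?J. r * a \<in> ring_of_integers K)"
  proof -
    obtain d where d: "d \<in> ring_of_integers K" "d \<noteq> 0" "\<And>x. x \<in> I \<Longrightarrow> d * x \<in> ring_of_integers K"
      using fractional_ideal_denominatorE[OF I] by metis
    obtain e where e: "e \<in> ring_of_integers K" "e \<noteq> 0" "e * c \<in> ring_of_integers K"
      using ex_denominator[OF c(1)] by blast
    have "(e * cnj d) * (c * cnj x) \<in> ring_of_integers K" if "x \<in> I" for x
      using integer_mult[OF e(3) integer_cnj[OF d(3)[OF that]]] by (simp add: mult_ac)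
    thus ?thesis using d e
      by (intro bexI[of _ "e * cnj d"]) (auto intro: integer_mult integer_cnj)
  qed
qed

text \<open>For an ideal \<open>I\<close> of integers, let \<open>g\<close> be the least positive rational integer in the product
  of \<open>I\<close> and its conjugate. All norms and all traces \<open>x * cnj y + y * cnj x\<close> lie in this product
  and are hence divisible by \<open>g\<close>, so \<open>x * cnj y / g\<close> is integral and the product is generated
  by \<open>g\<close>.\<close>

lemma fractional_ideal_inverse:
  assumes I: "fractional_ideal K I"
  shows "\<exists>J. fractional_ideal K J \<and> ideal_mult J I = ring_of_integers K"
proof -
  let ?O = "ring_of_integers K"
  obtain c where c: "c \<in> ?O" "c \<noteq> 0" "\<And>x. x \<in> I \<Longrightarrow> c * x \<in> ?O"
    using fractional_ideal_denominatorE[OF I] by metis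
  have cnorm: "c * cnj c \<in> K" "c * cnj c \<noteq> 0"
    using c by (auto intro: mult_in cnj_closed integer_in)
  \<comment> \<open>The factor \<open>c * cnj c\<close> clears denominators:
    \<open>ideal_mult J I\<close> is the product of the ideal of integers c I and its
    conjugate.\<close>
  define J where "J = (\<lambda>x. c * cnj c * cnj x) ` I"
  have J: "fractional_ideal K J"
    unfolding J_def using I cnorm by (rule fractional_ideal_scaled_cnj)
  have JI: "fractional_ideal K (ideal_mult J I)" using J I by (rule fractional_ideal_mult)
  have prod: "cnj (c * y) * (c * x) \<in> ideal_mult J I" if "x \<in> I" "y \<in> I" for x y
  proof -
    have "(c * cnj c * cnj y) * x \<in> ideal_mult J I" using that unfolding J_def by (intro ideal_multI) auto
    thus ?thesis by (simp add: mult_ac)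
  qed
  define A where "A = {m::int. of_int m \<in> ideal_mult J I}"
  have norm_A: "m \<in> A" if "x \<in> I" "(cmod (c * x))\<^sup>2 = of_int m" for x m
  proof -
    have "cnj (c * x) * (c * x) = of_real ((cmod (c * x))\<^sup>2)"
      by (simp only: complex_norm_square mult.commute)
    also have "\<dots> = of_int m" by (simp only: that(2) of_real_of_int_eq)
    finally show ?thesis using prod[OF that(1) that(1)] by (simp add: A_def)
  qed
  have trace_A: "m \<in> A" if "x \<in> I" "y \<in> I" "2 * Re (c * x * cnj (c * y)) = of_int m" for x y m
  proof -
    have "cnj (c * y) * (c * x) + cnj (c * x) * (c * y) = of_real (2 * Re (c * x * cnj (c * y)))"
      by (simp add: complex_eq_iff algebra_simps)
    also have "\<dots> = of_int m" by (simp only: that(3) of_real_of_int_eq)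
    finally show ?thesis using ideal_mult_add[OF prod[OF that(1,2)] prod[OF that(2,1)]] by (simp add: A_def)
  qed
  have A_smult: "k * m \<in> A" if "m \<in> A" for k m
    using that fractional_ideal_smult[OF JI integer_of_int, of "of_int m" k] by (simp add: A_def)
  have A_add: "k + m \<in> A" if "k \<in> A" "m \<in> A" for k m
    using that ideal_mult_add[of "of_int k" J I "of_int m"] by (simp add: A_def)
  have "\<exists>g::nat. g > 0 \<and> int g \<in> A"
  proof -
    obtain x where x: "x \<in> I" "x \<noteq> 0" using fractional_ideal_nonzeroE[OF I] by metis
    obtain m :: int where m: "(cmod (c * x))\<^sup>2 = of_int m"
      using integer_norm[OF c(3)[OF x(1)]] by (auto elim: Ints_cases)
    have "(cmod (c * x))\<^sup>2 > 0" using x c by simp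
    hence "m > 0" by (simp add: m)
    thus ?thesis using norm_A[OF x(1) m] by (intro exI[of _ "nat m"]) auto
  qed
  define g where "g = (LEAST g::nat. g > 0 \<and> int g \<in> A)"
  have g: "g > 0" "int g \<in> A"
    using LeastI_ex[OF \<open>\<exists>g::nat. g > 0 \<and> int g \<in> A\<close>] by (auto simp: g_def)
  have g_dvd: "int g dvd m" if "m \<in> A" for m
  proof (rule ccontr)
    assume "\<not> int g dvd m"
    hence "m mod int g > 0" using g(1) by (simp add: dvd_eq_mod_eq_0 order.not_eq_order_implies_strict)
    moreover have "m mod int g \<in> A"
    proof -
      have "m + (- (m div int g)) * int g \<in> A" using that g by (intro A_add A_smult)
      also have "m + (- (m div int g)) * int g = m mod int g" by (simp add: minus_div_mult_eq_mod)
      finally show ?thesis .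
    qed
    ultimately have "g \<le> nat (m mod int g)" unfolding g_def by (intro Least_le) auto
    moreover have "m mod int g < int g" using g(1) by simp
    moreover have "m mod int g \<ge> 0" using g(1) by simp
    ultimately show False by (simp add: le_nat_iff)
  qed
  have g_K: "(1 / of_nat g) \<in> K" by (intro divide_in of_nat_in one_in)
  \<comment> \<open>Trace and norm decide integrality. The trace of the numerator lies in
    \<open>A\<close>, hence is divisible by g; its norm is a product of two elements of
    \<open>A\<close>, hence is divisible by g^2.\<close>
  have quot: "cnj (c * y) * (c * x) / of_nat g \<in> ?O" if xy: "x \<in> I" "y \<in> I" for x y
    unfolding integer_iff
  proof (intro conjI)
    let ?z = "cnj (c * y) * (c * x)"
    show "?z / of_nat g \<in> K"
      using c xy by (intro divide_in mult_in cnj_closed of_nat_in integer_in)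
    obtain t :: int where t: "2 * Re (c * x * cnj (c * y)) = of_int t"
      using integer_trace_mult_cnj[OF c(3) c(3), OF xy] by (auto elim: Ints_cases)
    obtain t' where t': "t = int g * t'" using g_dvd[OF trace_A[OF xy t]] by (elim dvdE)
    have "?z = c * x * cnj (c * y)" by (rule mult.commute)
    hence "2 * Re (?z / of_nat g) = 2 * Re (c * x * cnj (c * y)) / real g"
      by (simp only: Re_divide_of_nat times_divide_eq_right)
    also have "2 * Re (c * x * cnj (c * y)) / real g = of_int t'" using t g(1) by (simp only: t t') simp
    finally show "2 * Re (?z / of_nat g) \<in> \<int>" by (simp only: Ints_of_int)
    obtain k :: int where k: "(cmod (c * x))\<^sup>2 = of_int k"
      using integer_norm[OF c(3)[OF xy(1)]] by (auto elim: Ints_cases)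
    obtain l :: int where l: "(cmod (c * y))\<^sup>2 = of_int l"
      using integer_norm[OF c(3)[OF xy(2)]] by (auto elim: Ints_cases)
    obtain k' where k': "k = int g * k'" using g_dvd[OF norm_A[OF xy(1) k]] by (elim dvdE)
    obtain l' where l': "l = int g * l'" using g_dvd[OF norm_A[OF xy(2) l]] by (elim dvdE)
    have "(cmod (?z / of_nat g))\<^sup>2 = (cmod (c * y))\<^sup>2 * (cmod (c * x))\<^sup>2 / (real g)\<^sup>2"
      by (simp only: norm_divide norm_mult[of "cnj (c * y)"] complex_mod_cnj norm_of_nat power_divide power_mult_distrib)
    also have "\<dots> = of_int (k' * l')" using g(1) by (simp only: k l k' l') (simp add: power2_eq_square)
    finally show "(cmod (?z / of_nat g))\<^sup>2 \<in> \<int>" by (simp only: Ints_of_int)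
  qed
  define J' where "J' = ideal_mult (principal (1 / of_nat g)) J"
  have J': "fractional_ideal K J'"
    unfolding J'_def using J g_K g(1) by (intro fractional_ideal_mult fractional_ideal_principal) auto
  have J'_eq: "ideal_mult J' I = ideal_mult (principal (1 / of_nat g)) (ideal_mult J I)"
    by (simp add: J'_def ideal_mult_assoc)
  have scaled: "a / of_nat g \<in> ?O" if "a \<in> ideal_mult J I" for a
    using that
  proof (induction rule: ideal_mult_induct)
    case (prod a b)
    then obtain y where "y \<in> I" "a = c * cnj c * cnj y" by (auto simp: J_def)
    thus ?case using quot[of b y] prod by (simp add: mult_ac)
  qed (auto simp: add_divide_distrib intro: integer_add)
  have JI': "fractional_ideal K (ideal_mult J' I)" using J' I by (rule fractional_ideal_mult)
  have "ideal_mult J' I \<subseteq> ?O"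
  proof
    fix a assume "a \<in> ideal_mult J' I"
    thus "a \<in> ?O"
      unfolding J'_eq
    proof (induction rule: ideal_mult_induct)
      case (prod x y)
      then obtain u where "u \<in> ?O" "x = u / of_nat g" by auto
      thus ?case using integer_mult[OF _ scaled[OF prod(2)], of u] by simp
    qed (auto intro: integer_add)
  qed
  moreover have "1 \<in> ideal_mult J' I"
  proof -
    have "(1 / of_nat g) * of_int (int g) \<in> ideal_mult J' I"
      unfolding J'_eq using g(2) by (intro ideal_multI principal_self) (simp add: A_def)
    thus ?thesis using g(1) by simp
  qed
  hence "?O \<subseteq> ideal_mult J' I" using fractional_ideal_smult[OF JI', of _ 1] by auto
  ultimately show ?thesis using J' by blast
qed

lemma fractional_ideal_integers: "fractional_ideal K (ring_of_integers K)"
  using fractional_ideal_principal[of 1] by simp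

lemma comm_group_fractional_ideals: "comm_group (fractional_ideal_group K)"
proof (rule comm_groupI)
  fix I assume "I \<in> carrier (fractional_ideal_group K)"
  thus "\<exists>J\<in>carrier (fractional_ideal_group K).
      J \<otimes>\<^bsub>fractional_ideal_group K\<^esub> I = \<one>\<^bsub>fractional_ideal_group K\<^esub>"
    using fractional_ideal_inverse[of I] by (auto simp: fractional_ideal_group_def)
next
  fix I J
  show "I \<otimes>\<^bsub>fractional_ideal_group K\<^esub> J = J \<otimes>\<^bsub>fractional_ideal_group K\<^esub> I"
    by (simp add: fractional_ideal_group_def ideal_mult_commute)
qed (auto simp: fractional_ideal_group_def fractional_ideal_integers ideal_mult_assoc ideal_mult_unit
      intro: fractional_ideal_mult)

lemma subgroup_principal_fractional_ideals:
  "subgroup (principal_fractional_ideals K) (fractional_ideal_group K)"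
proof -
  interpret comm_group "fractional_ideal_group K" by (rule comm_group_fractional_ideals)
  have mult: "ideal_mult (principal x) (principal y) \<in> principal_fractional_ideals K"
    if "x \<in> K" "y \<in> K" "x \<noteq> 0" "y \<noteq> 0" for x y
    unfolding principal_fractional_ideals_def ideal_mult_principal[OF that]
    using that by (intro CollectI exI[of _ "x * y"]) (auto intro: mult_in)
  have inv: "inv\<^bsub>fractional_ideal_group K\<^esub> (principal x) = principal (inverse x)"
    if "x \<in> K" "x \<noteq> 0" for x
    using that ideal_mult_principal[of "inverse x" x]
    by (intro inv_equality)
      (auto simp: fractional_ideal_group_def inverse_in fractional_ideal_principal)
  show ?thesis
  proof
    show "principal_fractional_ideals K \<subseteq> carrier (fractional_ideal_group K)"
      by (auto simp: principal_fractional_ideals_def fractional_ideal_group_def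
          intro: fractional_ideal_principal)
    show "\<one>\<^bsub>fractional_ideal_group K\<^esub> \<in> principal_fractional_ideals K"
      by (auto simp: principal_fractional_ideals_def fractional_ideal_group_def intro!: exI[of _ 1])
    fix I assume "I \<in> principal_fractional_ideals K"
    then obtain x where x: "x \<in> K" "x \<noteq> 0" "I = principal x"
      by (auto simp: principal_fractional_ideals_def)
    show "inv\<^bsub>fractional_ideal_group K\<^esub> I \<in> principal_fractional_ideals K"
      unfolding x(3) inv[OF x(1,2)] unfolding principal_fractional_ideals_def
      using x by (intro CollectI exI[of _ "inverse x"]) (auto intro: inverse_in)
    fix J assume "J \<in> principal_fractional_ideals K"
    then obtain y where y: "y \<in> K" "y \<noteq> 0" "J = principal y"
      by (auto simp: principal_fractional_ideals_def)
    show "I \<otimes>\<^bsub>fractional_ideal_group K\<^esub> J \<in> principal_fractional_ideals K"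
      using mult[of x y] x y by (simp add: fractional_ideal_group_def)
  qed
qed

end

section \<open>Imaginary quadratic fields\<close>

lemma Rats_complexE:
  assumes "x \<in> (\<rat> :: complex set)"
  obtains r where "r \<in> \<rat>" "x = complex_of_real r"
proof -
  obtain a b :: int where "x = of_int a / of_int b" using assms by (elim Rats_cases')
  thus thesis using that[of "of_int a / of_int b"] by simp
qed

lemma csqrt_of_neg_int:
  assumes "d < 0"
  shows "csqrt (of_int d) = \<i> * of_real (sqrt (of_int (- d)))"
  using assms by simp

lemma rat_sqrt_field_eq:
  assumes d: "d < 0"
  shows "rat_sqrt_field d = {x + y * csqrt (of_int d) | x y. x \<in> \<rat> \<and> y \<in> \<rat>}" (is "_ = ?Q")
  unfolding rat_sqrt_field_def
proof (rule hull_unique)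
  let ?s = "csqrt (of_int d)"
  have s2: "?s * ?s = of_int d" by (metis power2_csqrt power2_eq_square)
  have mem: "x + y * ?s \<in> ?Q" if "x \<in> \<rat>" "y \<in> \<rat>" for x y using that by blast
  show "{?s} \<subseteq> ?Q" using mem[of 0 1] by simp
  show "complex_subfield ?Q"
    unfolding complex_subfield_def
  proof (intro conjI ballI)
    show "1 \<in> ?Q" using mem[of 1 0] by simp
    fix a assume "a \<in> ?Q"
    then obtain x y where a: "a = x + y * ?s" "x \<in> \<rat>" "y \<in> \<rat>" by blast
    show "inverse a \<in> ?Q"
    proof (cases "a = 0")
      case True
      thus ?thesis using mem[of 0 0] by simp
    next
      case False
      obtain r t where rt: "x = of_real r" "y = of_real t" "r \<in> \<rat>" "t \<in> \<rat>"
        using a Rats_complexE by metis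
      have D: "x * x - of_int d * y * y = of_real (r\<^sup>2 + of_int (- d) * t\<^sup>2)"
        by (simp add: rt power2_eq_square)
      have "r\<^sup>2 + of_int (- d) * t\<^sup>2 \<noteq> 0"
      proof
        assume "r\<^sup>2 + of_int (- d) * t\<^sup>2 = 0"
        moreover have "real_of_int (- d) * t\<^sup>2 \<ge> 0" "r\<^sup>2 \<ge> 0" using d by (simp_all add: mult_nonpos_nonneg)
        ultimately have "r\<^sup>2 = 0" "real_of_int (- d) * t\<^sup>2 = 0" by linarith+
        thus False using False d by (simp add: a rt)
      qed
      hence nz: "x * x - of_int d * y * y \<noteq> 0" by (simp only: D of_real_eq_0_iff not_False_eq_True)
      have "a * ((x - y * ?s) / (x * x - of_int d * y * y)) = (x * x - y * y * (?s * ?s)) / (x * x - of_int d * y * y)"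
        by (simp add: a algebra_simps)
      also have "\<dots> = 1" using nz by (simp add: s2 mult_ac)
      finally have "inverse a = (x - y * ?s) / (x * x - of_int d * y * y)"
        by (rule inverse_unique)
      also have "\<dots> = x / (x * x - of_int d * y * y) + (- y / (x * x - of_int d * y * y)) * ?s"
        by (simp add: diff_divide_distrib)
      also have "\<dots> \<in> ?Q" using a by (intro mem) auto
      finally show ?thesis .
    qed
    fix b assume "b \<in> ?Q"
    then obtain u v where b: "b = u + v * ?s" "u \<in> \<rat>" "v \<in> \<rat>" by blast
    have "a - b = (x - u) + (y - v) * ?s" by (simp add: a b algebra_simps)
    also have "\<dots> \<in> ?Q" using a b by (intro mem) auto
    finally show "a - b \<in> ?Q" .
    have "a * b = (x * u + y * v * (?s * ?s)) + (x * v + y * u) * ?s" by (simp add: a b algebra_simps)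
    also have "\<dots> \<in> ?Q" unfolding s2 using a b by (intro mem) auto
    finally show "a * b \<in> ?Q" .
  qed
  fix T assume T: "{?s} \<subseteq> T" "complex_subfield T"
  then interpret subfield_of_complex T by unfold_locales
  show "?Q \<subseteq> T" using T(1) by (auto intro: add_in mult_in Rats_in)
qed

lemma rat_sqrt_fieldE:
  assumes "d < 0" "x \<in> rat_sqrt_field d"
  obtains a b where "a \<in> \<rat>" "b \<in> \<rat>" "Re x = a" "Im x = b * sqrt (of_int (- d))"
    "x = of_real a + of_real b * csqrt (of_int d)"
proof -
  obtain u v where uv: "x = u + v * csqrt (of_int d)" "u \<in> \<rat>" "v \<in> \<rat>"
    using assms rat_sqrt_field_eq by blast
  obtain a b where ab: "u = of_real a" "v = of_real b" "a \<in> \<rat>" "b \<in> \<rat>"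
    using uv Rats_complexE by metis
  show thesis
    by (rule that[OF ab(3,4)]) (use assms in \<open>simp_all add: uv ab csqrt_of_neg_int del: of_int_minus\<close>)
qed

lemma rat_sqrt_fieldI:
  assumes "d < 0" "x \<in> \<rat>" "y \<in> \<rat>"
  shows "x + y * csqrt (of_int d) \<in> rat_sqrt_field d"
  using assms by (auto simp: rat_sqrt_field_eq)

lemma complex_subfield_rat_sqrt_field: "complex_subfield (rat_sqrt_field d)"
  unfolding rat_sqrt_field_def
proof (rule hull_in)
  show "complex_subfield (\<Inter>T)" if "Ball T complex_subfield" for T
    using that by (auto simp: complex_subfield_def)
qed

lemma imaginary_field_rat_sqrt_field:
  assumes d: "d < 0"
  shows "imaginary_field (rat_sqrt_field d)"
proof
  fix x assume "x \<in> rat_sqrt_field d"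
  then obtain a b where ab: "a \<in> \<rat>" "b \<in> \<rat>" "Re x = a" "x = of_real a + of_real b * csqrt (of_int d)"
    using d by (elim rat_sqrt_fieldE)
  show "Re x \<in> \<rat>" using ab(1,3) by simp
  have "cnj x = of_real a + of_real (- b) * csqrt (of_int d)"
    using d by (simp add: ab(4) csqrt_of_neg_int)
  also have "\<dots> \<in> rat_sqrt_field d" using d ab by (intro rat_sqrt_fieldI) auto
  finally show "cnj x \<in> rat_sqrt_field d" .
qed (rule complex_subfield_rat_sqrt_field)

lemma vector_space_rat_complex: "vector_space (\<lambda>(q::rat) (z::complex). of_rat q * z)"
  by unfold_locales (simp_all add: algebra_simps of_rat_add of_rat_mult)

lemma imaginary_quadratic_field_rat_sqrt_field:
  assumes d: "d < 0"
  shows "imaginary_quadratic_field (rat_sqrt_field d)"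
proof -
  interpret vector_space "\<lambda>(q::rat) (z::complex). of_rat q * z"
    by (rule vector_space_rat_complex)
  let ?s = "csqrt (of_int d)"
  have Im_s: "Im ?s \<noteq> 0" using d by (simp add: csqrt_of_neg_int)
  have sp1: "span {1} = (\<rat> :: complex set)"
    by (auto simp: span_singleton Rats_def)
  have s_notin: "?s \<notin> span {1}"
    using Im_s unfolding sp1 by (metis Im_complex_of_real Rats_complexE)
  have "independent {?s, 1}"
    using s_notin by (intro independent_insertI independent_empty) auto
  moreover have sp: "span {?s, 1} = rat_sqrt_field d"
  proof (intro equalityI subsetI)
    fix x assume "x \<in> span {?s, 1}"
    then obtain k where "x - of_rat k * ?s \<in> \<rat>" unfolding span_breakdown_eq sp1 by blast
    hence "(x - of_rat k * ?s) + of_rat k * ?s \<in> rat_sqrt_field d" using d by (intro rat_sqrt_fieldI) auto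
    thus "x \<in> rat_sqrt_field d" by simp
  next
    fix x assume "x \<in> rat_sqrt_field d"
    then obtain u v where uv: "x = u + v * ?s" "u \<in> \<rat>" "v \<in> \<rat>"
      using d rat_sqrt_field_eq by blast
    obtain k where "v = of_rat k" using uv(3) by (elim Rats_cases)
    thus "x \<in> span {?s, 1}" unfolding span_breakdown_eq sp1 using uv by (intro exI[of _ k]) auto
  qed
  ultimately have "dim (rat_sqrt_field d) = card {?s, 1}"
    by (intro dim_eq_card) (simp_all add: span_span flip: sp)
  moreover have "?s \<noteq> 1" using s_notin sp1 by auto
  ultimately have "rat_degree (rat_sqrt_field d) = 2" by (simp add: rat_degree_def)
  moreover have "?s \<in> rat_sqrt_field d" using rat_sqrt_fieldI[OF d, of 0 1] by simp
  hence "\<not> rat_sqrt_field d \<subseteq> \<real>" using Im_s by (auto simp: complex_is_Real_iff)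
  ultimately show ?thesis
    by (simp add: imaginary_quadratic_field_def complex_subfield_rat_sqrt_field)
qed

lemma rat_sqrt_field_square_mult:
  fixes c d :: int
  assumes "c > 0" "d < 0"
  shows "rat_sqrt_field (c\<^sup>2 * d) = rat_sqrt_field d"
proof -
  have neg: "c\<^sup>2 * d < 0" using assms by (simp add: mult_pos_neg)
  have s: "csqrt (of_int (c\<^sup>2 * d)) = of_int c * csqrt (of_int d)"
  proof -
    have "sqrt (of_int (- (c\<^sup>2 * d))) = sqrt ((of_int c)\<^sup>2 * of_int (- d))" by simp
    also have "\<dots> = of_int c * sqrt (of_int (- d))"
      using assms by (simp only: real_sqrt_mult real_sqrt_power[symmetric] real_sqrt_pow2) simp
    finally show ?thesis
      unfolding csqrt_of_neg_int[OF neg] csqrt_of_neg_int[OF assms(2)] by (simp only: of_real_mult of_real_of_int_eq mult_ac)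
  qed
  interpret K1: subfield_of_complex "rat_sqrt_field (c\<^sup>2 * d)"
    by unfold_locales (rule complex_subfield_rat_sqrt_field)
  interpret K2: subfield_of_complex "rat_sqrt_field d"
    by unfold_locales (rule complex_subfield_rat_sqrt_field)
  have gen: "csqrt (of_int e) \<in> rat_sqrt_field e" for e
    unfolding rat_sqrt_field_def by (rule hull_inc) simp
  have "csqrt (of_int (c\<^sup>2 * d)) \<in> rat_sqrt_field d"
    unfolding s by (intro K2.mult_in K2.of_int_in gen)
  moreover have "csqrt (of_int (c\<^sup>2 * d)) / of_int c \<in> rat_sqrt_field (c\<^sup>2 * d)"
    by (intro K1.divide_in K1.of_int_in gen)
  hence "csqrt (of_int d) \<in> rat_sqrt_field (c\<^sup>2 * d)" unfolding s using assms by simp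
  ultimately show ?thesis
    by (metis complex_subfield_rat_sqrt_field empty_subsetI equalityI hull_minimal insert_subset rat_sqrt_field_def)
qed

text \<open>Comparing imaginary parts gives d = b^2 e with b rational. Then d e = (b e)^2, and a
  rational number with integral square is an integer.\<close>

lemma rat_sqrt_field_eq_imp_square:
  assumes "d < 0" "e < 0" and eq: "rat_sqrt_field d = rat_sqrt_field e"
  shows "\<exists>k::int. d * e = k\<^sup>2"
proof -
  have "csqrt (of_int d) \<in> rat_sqrt_field e"
    using rat_sqrt_fieldI[OF assms(1), of 0 1] eq by simp
  then obtain b where b: "b \<in> \<rat>" "Im (csqrt (of_int d)) = b * sqrt (of_int (- e))"
    using assms(2) by (elim rat_sqrt_fieldE)
  have "sqrt (of_int (- d)) = b * sqrt (of_int (- e))" using b(2) assms(1) by (simp add: csqrt_of_neg_int)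
  hence "(sqrt (of_int (- d)))\<^sup>2 = b\<^sup>2 * (sqrt (of_int (- e)))\<^sup>2" by (simp add: power_mult_distrib)
  hence "of_int (- d) = b\<^sup>2 * of_int (- e)" using assms by simp
  hence sq: "(b * of_int e)\<^sup>2 = of_int (d * e)" by (simp add: power2_eq_square algebra_simps)
  have "b * of_int e \<in> \<rat>" using b(1) by simp
  hence "b * of_int e \<in> \<int>" by (rule rat_sqr_int_imp_int) (simp only: sq Ints_of_int)
  then obtain k :: int where "b * of_int e = of_int k" by (auto elim: Ints_cases)
  hence "of_int (k\<^sup>2) = (of_int (d * e) :: real)" using sq by (simp only: of_int_power)
  thus ?thesis by (metis of_int_eq_iff)
qed

section \<open>An ideal class of order \<open>n\<close>\<close>

text \<open>The Lucas sequence V_k(a, v) of the second kind: the sum of the k-th powers of the two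
  roots of X^2 - a X + v.\<close>

fun lucas :: "int \<Rightarrow> int \<Rightarrow> nat \<Rightarrow> int" where
  "lucas a v 0 = 2"
| "lucas a v (Suc 0) = a"
| "lucas a v (Suc (Suc k)) = a * lucas a v (Suc k) - v * lucas a v k"

text \<open>x and its conjugate are the roots of X^2 - a X + v, so the traces of the powers satisfy
  the Lucas recursion.\<close>

lemma lucas_eq_trace_power:
  assumes "2 * Re x = of_int a" "(cmod x)\<^sup>2 = of_int v"
  shows "2 * Re (x ^ k) = of_int (lucas a v k)"
proof (induction k rule: induct_nat_012)
  case (ge2 k)
  have Re_scale: "Re (of_real r * z) = r * Re z" for r z by simp
  have "x ^ Suc (Suc k) = of_real (2 * Re x) * x ^ Suc k - of_real ((cmod x)\<^sup>2) * x ^ k"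
  proof -
    have "x * x = of_real (2 * Re x) * x - of_real ((cmod x)\<^sup>2)"
      unfolding cmod_power2 by (simp add: complex_eq_iff power2_eq_square algebra_simps)
    hence "x * x * x ^ k = (of_real (2 * Re x) * x - of_real ((cmod x)\<^sup>2)) * x ^ k" by simp
    thus ?thesis by (simp add: algebra_simps)
  qed
  hence "Re (x ^ Suc (Suc k)) = 2 * Re x * Re (x ^ Suc k) - (cmod x)\<^sup>2 * Re (x ^ k)"
    by (simp only: minus_complex.sel Re_scale)
  hence "2 * Re (x ^ Suc (Suc k)) = 2 * Re x * (2 * Re (x ^ Suc k)) - (cmod x)\<^sup>2 * (2 * Re (x ^ k))"
    by (simp only: right_diff_distrib mult_ac)
  thus ?case by (simp only: ge2 assms lucas.simps of_int_mult of_int_diff)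
qed (use assms in auto)

lemma dvd_lucas_odd: "a dvd lucas a v (Suc (2 * k))"
  by (induction k) auto

text \<open>Expanded in powers of v, V_l begins with a^l - l a^(l - 2) v. For l = k + 2 and a^2 = 1
  these two terms are the expression subtracted here.\<close>

lemma lucas_cong:
  assumes "a * a = 1"
  shows "v\<^sup>2 dvd lucas a v (k + 2) - a ^ k * (1 - int (k + 2) * v)"
proof (induction k rule: induct_nat_012)
  case 0
  show ?case using assms by (simp add: numeral_2_eq_2)
next
  case 1
  have "lucas a v (1 + 2) = a * (a * a) - 3 * (a * v)" by (simp add: numeral_3_eq_3 algebra_simps)
  thus ?case by (simp add: assms algebra_simps)
next
  case (ge2 k)
  define P where "P = lucas a v (Suc k + 2) - a ^ Suc k * (1 - int (Suc k + 2) * v)"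
  define Q where "Q = lucas a v (k + 2) - a ^ k * (1 - int (k + 2) * v)"
  have aa: "a ^ Suc (Suc k) = a ^ k" using assms by simp
  have "lucas a v (Suc (Suc k) + 2) - a ^ Suc (Suc k) * (1 - int (Suc (Suc k) + 2) * v)
      = a * lucas a v (Suc k + 2) - v * lucas a v (k + 2) - a ^ k * (1 - int (k + 4) * v)"
    unfolding aa by simp
  also have "\<dots> = a * P - v * Q + a * a * a ^ k * (1 - int (k + 3) * v)
      - v * (a ^ k * (1 - int (k + 2) * v)) - a ^ k * (1 - int (k + 4) * v)"
    unfolding P_def Q_def by (simp add: algebra_simps)
  \<comment> \<open>The terms of degree 0 and 1 in v cancel, because a^2 = 1 and (k + 3) + 1 = k +
    4.\<close>
  also have "\<dots> = a * P - v * Q + v\<^sup>2 * (a ^ k * int (k + 2))"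
    unfolding assms by (simp add: algebra_simps power2_eq_square)
  also have "v\<^sup>2 dvd \<dots>" using ge2 by (auto simp: P_def Q_def)
  finally show ?case .
qed

text \<open>At an odd index a divides V_l = 1, so a is 1 or -1. For a = -1 the congruence modulo v
  would make v divide 2, against v \<ge> 3. For a = 1 the congruence says that v^2 divides l
  v.\<close>

lemma lucas_eq_1_imp_dvd:
  assumes "odd l" "l \<ge> 3" "v \<ge> 3" "lucas a v l = 1"
  shows "v dvd int l"
proof -
  obtain k where k: "l = Suc (2 * k)" using assms(1) by (auto elim: oddE)
  have "a dvd 1" using dvd_lucas_odd[of a v k] assms(4) by (simp add: k)
  hence a: "a = 1 \<or> a = -1" by auto
  hence aa: "a * a = 1" by auto
  obtain j where j: "l = j + 2" using assms(2) by (metis add.commute le_Suc_ex numeral_3_eq_3 add_2_eq_Suc Suc_leD numeral_2_eq_2)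
  have "a ^ j = a"
  proof -
    have "odd j" using assms(1) by (simp add: j)
    thus ?thesis using a by auto
  qed
  hence dvd: "v\<^sup>2 dvd 1 - a * (1 - int l * v)" using lucas_cong[OF aa, of v j] assms(4) by (simp add: j)
  have "a = 1"
  proof (rule ccontr)
    assume "a \<noteq> 1"
    hence "a = -1" using a by simp
    have "v dvd 2 - int l * v" using dvd_trans[OF _ dvd, of v] \<open>a = -1\<close> by (simp add: power2_eq_square)
    moreover have "v dvd int l * v" by simp
    ultimately have "v dvd 2" by (metis dvd_diffD dvd_diff_commute diff_add_cancel dvd_add)
    thus False using assms(3) by (auto dest: zdvd_imp_le)
  qed
  hence "v * v dvd v * int l" using dvd by (simp add: power2_eq_square mult.commute)
  thus ?thesis using assms(3) by simp
qed

section \<open>Powers of an ideal with two generators\<close>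

context imaginary_field
begin

abbreviation pair_ideal :: "complex \<Rightarrow> complex \<Rightarrow> complex set" where
  "pair_ideal a b \<equiv> {x * a + y * b | x y. x \<in> ring_of_integers K \<and> y \<in> ring_of_integers K}"

lemma fractional_ideal_pair:
  assumes a: "a \<in> ring_of_integers K" and b: "b \<in> ring_of_integers K" and nz: "a \<noteq> 0"
  shows "fractional_ideal K (pair_ideal a b)"
proof -
  let ?O = "ring_of_integers K"
  have mem: "x * a + y * b \<in> pair_ideal a b" if "x \<in> ?O" "y \<in> ?O" for x y using that by blast
  have sub: "pair_ideal a b \<subseteq> ?O" using a b by (auto intro: integer_add integer_mult)
  show ?thesis
    unfolding fractional_ideal_def
  proof (intro conjI ballI)
    show "pair_ideal a b \<subseteq> K" using sub integer_in by blast
    show "0 \<in> pair_ideal a b" using mem[of 0 0] by simp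
    have "a \<in> pair_ideal a b" using mem[of 1 0] by simp
    thus "pair_ideal a b \<noteq> {0}" using nz by blast
    show "\<exists>c\<in>?O. c \<noteq> 0 \<and> (\<forall>x\<in>pair_ideal a b. c * x \<in> ?O)"
      using sub by (intro bexI[of _ 1]) auto
    fix z assume "z \<in> pair_ideal a b"
    then obtain x y where z: "z = x * a + y * b" "x \<in> ?O" "y \<in> ?O" by blast
    show "c * z \<in> pair_ideal a b" if "c \<in> ?O" for c
      using mem[OF integer_mult[OF that z(2)] integer_mult[OF that z(3)]] by (simp add: z(1) algebra_simps)
    fix w assume "w \<in> pair_ideal a b"
    then obtain u v where w: "w = u * a + v * b" "u \<in> ?O" "v \<in> ?O" by blast
    show "z + w \<in> pair_ideal a b"
      using mem[OF integer_add[OF z(2) w(2)] integer_add[OF z(3) w(3)]] by (simp add: z(1) w(1) algebra_simps)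
  qed
qed

text \<open>In a product of j combinations of a and b, every term other than a multiple of
  \<open>a ^ j\<close> contains the factor b.\<close>

lemma pair_ideal_pow:
  assumes x: "x \<in> pair_ideal a b [^]\<^bsub>fractional_ideal_group K\<^esub> j"
    and a: "a \<in> ring_of_integers K" and b: "b \<in> ring_of_integers K"
  shows "x \<in> pair_ideal (a ^ j) b"
  using x
proof (induction j arbitrary: x)
  case 0
  hence "x \<in> ring_of_integers K" by (simp add: fractional_ideal_group_def)
  thus ?case by (intro CollectI exI[of _ x] exI[of _ 0]) auto
next
  case (Suc j)
  let ?O = "ring_of_integers K"
  have mem: "u * a ^ Suc j + v * b \<in> pair_ideal (a ^ Suc j) b" if "u \<in> ?O" "v \<in> ?O" for u v
    using that by blast
  have "x \<in> ideal_mult (pair_ideal a b [^]\<^bsub>fractional_ideal_group K\<^esub> j) (pair_ideal a b)"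
    using Suc.prems by (simp add: fractional_ideal_group_def)
  thus ?case
  proof (induction rule: ideal_mult_induct)
    case zero
    show ?case using mem[of 0 0] by simp
  next
    case (add z w)
    obtain x y where z: "z = x * a ^ Suc j + y * b" "x \<in> ?O" "y \<in> ?O" using add(1) by blast
    obtain u v where w: "w = u * a ^ Suc j + v * b" "u \<in> ?O" "v \<in> ?O" using add(2) by blast
    show ?case
      using mem[OF integer_add[OF z(2) w(2)] integer_add[OF z(3) w(3)]] by (simp add: z(1) w(1) algebra_simps)
  next
    case (prod z w)
    obtain x y where z: "z = x * a ^ j + y * b" "x \<in> ?O" "y \<in> ?O" using Suc.IH[OF prod(1)] by blast
    obtain u v where w: "w = u * a + v * b" "u \<in> ?O" "v \<in> ?O" using prod(2) by blast
    have "w \<in> ?O" using w a b by (auto intro: integer_add integer_mult)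
    have "z * w = (x * u) * a ^ Suc j + (x * a ^ j * v + y * w) * b"
      unfolding z(1) by (simp add: w(1) algebra_simps)
    also have "\<dots> \<in> pair_ideal (a ^ Suc j) b"
      using z w a \<open>w \<in> ?O\<close> by (intro mem integer_add integer_mult integer_power)
    finally show ?case .
  qed
qed

lemma power_in_ideal_pow:
  "x \<in> I \<Longrightarrow> x ^ j \<in> I [^]\<^bsub>fractional_ideal_group K\<^esub> j"
proof (induction j)
  case (Suc j)
  thus ?case using ideal_multI[of "x ^ j" _ x I]
    by (simp add: fractional_ideal_group_def mult.commute)
qed (simp add: fractional_ideal_group_def)

lemma principal_pow:
  assumes "x \<in> K" "x \<noteq> 0"
  shows "principal x [^]\<^bsub>fractional_ideal_group K\<^esub> (j::nat) = principal (x ^ j)"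
proof (induction j)
  case (Suc j)
  thus ?case using assms ideal_mult_principal[of "x ^ j" x]
    by (simp add: fractional_ideal_group_def power_in mult.commute)
qed (simp add: fractional_ideal_group_def)

text \<open>I^n lies in (U^n, \<alpha>), which is (\<alpha>) because U^n = \<alpha> cnj \<alpha>. In
  the other direction, I^n contains \<alpha>^n and U^n; multiplying a relation 1 = \<alpha>^(n - 1)
  + w cnj \<alpha> by \<alpha> writes \<alpha> as a combination of these two.\<close>

lemma pair_ideal_pow_eq_principal:
  fixes U :: int
  assumes \<alpha>: "\<alpha> \<in> ring_of_integers K" and tr: "\<alpha> + cnj \<alpha> = 1"
    and norm: "\<alpha> * cnj \<alpha> = of_int U ^ n" and n: "n > 0" and U: "U \<noteq> 0"
  shows "pair_ideal (of_int U) \<alpha> [^]\<^bsub>fractional_ideal_group K\<^esub> n = principal \<alpha>"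
proof -
  let ?O = "ring_of_integers K" and ?I = "pair_ideal (of_int U) \<alpha>"
  let ?P = "?I [^]\<^bsub>fractional_ideal_group K\<^esub> n"
  interpret comm_group "fractional_ideal_group K" by (rule comm_group_fractional_ideals)
  have "fractional_ideal K ?I"
    using \<alpha> U by (intro fractional_ideal_pair integer_of_int) auto
  hence "?I \<in> carrier (fractional_ideal_group K)" by (simp add: fractional_ideal_group_def)
  hence "?P \<in> carrier (fractional_ideal_group K)" by (rule nat_pow_closed)
  hence P: "fractional_ideal K ?P" by (simp add: fractional_ideal_group_def)
  have "?P \<subseteq> principal \<alpha>"
  proof
    fix x assume "x \<in> ?P"
    then obtain u v where x: "x = u * of_int U ^ n + v * \<alpha>" "u \<in> ?O" "v \<in> ?O"
      using pair_ideal_pow[OF _ integer_of_int \<alpha>] by blast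
    have "x = \<alpha> * (u * cnj \<alpha> + v)" by (simp add: x(1) norm[symmetric] algebra_simps)
    thus "x \<in> principal \<alpha>" using x \<alpha> by (auto intro!: imageI integer_add integer_mult integer_cnj)
  qed
  moreover have "\<alpha> \<in> ?P"
  proof -
    \<comment> \<open>\<open>\<alpha>\<close> and its conjugate are coprime, hence so are \<open>\<alpha> ^ (n - 1)\<close> and the conjugate.\<close>
    have "\<exists>w\<in>?O. 1 = \<alpha> ^ j + cnj \<alpha> * w" for j
    proof (induction j)
      case 0
      show ?case by (intro bexI[of _ 0]) auto
    next
      case (Suc j)
      then obtain w where w: "w \<in> ?O" "1 = \<alpha> ^ j + cnj \<alpha> * w" by blast
      have "1 = \<alpha> * (\<alpha> ^ j + cnj \<alpha> * w) + cnj \<alpha>" using tr by (simp flip: w(2))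
      also have "\<dots> = \<alpha> ^ Suc j + cnj \<alpha> * (\<alpha> * w + 1)" by (simp add: algebra_simps)
      finally show ?case using w \<alpha> by (intro bexI[of _ "\<alpha> * w + 1"]) (auto intro: integer_add integer_mult)
    qed
    from this[of "n - 1"] obtain w where w: "w \<in> ?O" "1 = \<alpha> ^ (n - 1) + cnj \<alpha> * w" by blast
    have "\<alpha> * 1 = \<alpha> * (\<alpha> ^ (n - 1) + cnj \<alpha> * w)" by (rule arg_cong[OF w(2), of "(*) \<alpha>"])
    also have "\<dots> = \<alpha> ^ n + w * (\<alpha> * cnj \<alpha>)"
      using n by (simp add: algebra_simps power_eq_if)
    finally have eq: "\<alpha> = \<alpha> ^ n + w * of_int U ^ n" by (simp only: norm mult_1_right)
    have "\<alpha> ^ n \<in> ?P"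
      by (rule power_in_ideal_pow, rule CollectI, rule exI[of _ 0], rule exI[of _ 1]) auto
    moreover have "of_int U ^ n \<in> ?P"
      by (rule power_in_ideal_pow, rule CollectI, rule exI[of _ 1], rule exI[of _ 0]) auto
    ultimately have "\<alpha> ^ n + w * of_int U ^ n \<in> ?P"
      by (intro fractional_ideal_add[OF P] fractional_ideal_smult[OF P w(1)])
    thus ?thesis by (simp only: eq[symmetric])
  qed
  hence "principal \<alpha> \<subseteq> ?P" using fractional_ideal_smult[OF P] by (auto simp: mult.commute)
  ultimately show ?thesis by blast
qed

text \<open>The generators divide each other, so the norms of the two quotients are nonnegative
  integers with product 1.\<close>

lemma principal_eq_imp_unit:
  assumes eq: "principal x = principal y" and x: "x \<noteq> 0"
  shows "\<exists>u\<in>ring_of_integers K. x = y * u \<and> cmod u = 1"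
proof -
  obtain u v where uv: "u \<in> ring_of_integers K" "x = y * u" "v \<in> ring_of_integers K" "y = x * v"
    using eq principal_self[of x] principal_self[of y] by (metis (no_types, lifting) imageE)
  have "x * (u * v) = x * 1" using uv(2,4) by (metis mult.assoc mult.commute mult.right_neutral)
  hence "u * v = 1" by (simp only: mult_left_cancel[OF x])
  hence prod: "(cmod u)\<^sup>2 * (cmod v)\<^sup>2 = 1"
    by (metis norm_mult norm_one one_power2 power_mult_distrib)
  obtain a b :: int where ab: "(cmod u)\<^sup>2 = of_int a" "(cmod v)\<^sup>2 = of_int b"
    using integer_norm[OF uv(1)] integer_norm[OF uv(3)] by (auto elim!: Ints_cases)
  have "of_int (a * b) = (of_int 1 :: real)" using prod ab by simp
  hence "a * b = 1" by (simp only: of_int_eq_iff)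
  moreover have "a \<ge> 0" using ab(1) by (metis of_int_0_le_iff zero_le_power2)
  ultimately have "a = 1" by (simp add: zmult_eq_1_iff)
  hence "(cmod u)\<^sup>2 = 1\<^sup>2" using ab(1) by simp
  hence "cmod u = 1" by (rule power2_eq_imp_eq) auto
  thus ?thesis using uv by blast
qed

text \<open>An infinite class group would have order 0 here, which \<open>n\<close> divides as well.\<close>

theorem dvd_class_number:
  fixes U :: int and n :: nat
  assumes \<alpha>: "\<alpha> \<in> K" and Re: "Re \<alpha> = 1 / 2" and norm: "(cmod \<alpha>)\<^sup>2 = of_int U ^ n"
    and units: "\<And>u. u \<in> ring_of_integers K \<Longrightarrow> cmod u = 1 \<Longrightarrow> u = 1 \<or> u = -1"
    and n: "odd n" and U: "U > int n" "U \<ge> 3"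
  shows "n dvd class_number K"
proof -
  let ?O = "ring_of_integers K" and ?G = "fractional_ideal_group K" and ?P = "principal_fractional_ideals K"
  let ?I = "pair_ideal (of_int U) \<alpha>"
  have \<alpha>O: "\<alpha> \<in> ?O" using \<alpha> by (simp add: integer_iff Re norm)
  have "\<alpha> \<noteq> 0" using Re by auto
  interpret G: comm_group ?G by (rule comm_group_fractional_ideals)
  have sub: "subgroup ?P ?G" by (rule subgroup_principal_fractional_ideals)
  interpret N: normal ?P ?G using sub by (rule G.subgroup_imp_normal)
  interpret C: group "?G Mod ?P" by (rule N.factorgroup_is_group)
  have I: "?I \<in> carrier ?G"
    using fractional_ideal_pair[OF integer_of_int \<alpha>O, of U] U by (simp add: fractional_ideal_group_def)
  have In: "?I [^]\<^bsub>?G\<^esub> n = principal \<alpha>"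
  proof (rule pair_ideal_pow_eq_principal[OF \<alpha>O])
    show "\<alpha> + cnj \<alpha> = 1" by (simp add: complex_eq_iff Re)
    have "\<alpha> * cnj \<alpha> = of_real ((cmod \<alpha>)\<^sup>2)" by (simp only: complex_norm_square)
    thus "\<alpha> * cnj \<alpha> = of_int U ^ n" unfolding norm by simp
    show "n > 0" using n by (rule odd_pos)
  qed (use U in simp)
  let ?c = "?P #>\<^bsub>?G\<^esub> ?I"
  have c: "?c \<in> carrier (?G Mod ?P)" using I by (simp add: carrier_FactGroup)
  have pow_iff: "?c [^]\<^bsub>?G Mod ?P\<^esub> j = \<one>\<^bsub>?G Mod ?P\<^esub> \<longleftrightarrow> ?I [^]\<^bsub>?G\<^esub> j \<in> ?P" for j :: nat
    unfolding N.FactGroup_pow[OF I] one_FactGroup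
    using G.coset_join1[OF _ _ sub] G.coset_join2[OF _ sub] I by blast
  define k where "k = C.ord ?c"
  have "?I [^]\<^bsub>?G\<^esub> n \<in> ?P"
    unfolding In principal_fractional_ideals_def using \<alpha> \<open>\<alpha> \<noteq> 0\<close> by blast
  hence "k dvd n" using C.pow_eq_id[OF c] pow_iff by (simp add: k_def)
  then obtain l where l: "n = k * l" by (elim dvdE)
  have "l = 1"
  proof (rule ccontr)
    assume "l \<noteq> 1"
    have "odd k" "odd l" using n unfolding l by simp_all
    have "k > 0" using \<open>odd k\<close> by (rule odd_pos)
    have "l \<ge> 3" using \<open>odd l\<close> \<open>l \<noteq> 1\<close> by presburger
    have "?I [^]\<^bsub>?G\<^esub> k \<in> ?P" using C.pow_ord_eq_1[OF c] pow_iff by (simp add: k_def)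
    then obtain \<beta> where \<beta>: "\<beta> \<in> K" "\<beta> \<noteq> 0" "?I [^]\<^bsub>?G\<^esub> k = principal \<beta>"
      unfolding principal_fractional_ideals_def by blast
    \<comment> \<open>The generator \<beta> lies in (U^k, \<alpha>), which consists of
      integers.\<close>
    have "\<beta> \<in> ?O"
    proof -
      have "\<beta> \<in> pair_ideal (of_int U ^ k) \<alpha>"
        using pair_ideal_pow[OF _ integer_of_int \<alpha>O] principal_self[of \<beta>] \<beta>(3) by blast
      thus ?thesis using \<alpha>O by (auto intro: integer_add integer_mult integer_power integer_of_int)
    qed
    have "principal \<alpha> = principal (\<beta> ^ l)"
      using G.nat_pow_pow[OF I, of k l] principal_pow[OF \<beta>(1,2), of l] by (simp add: In \<beta>(3) flip: l)
    then obtain u where u: "u \<in> ?O" "\<alpha> = \<beta> ^ l * u" "cmod u = 1"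
      using principal_eq_imp_unit \<open>\<alpha> \<noteq> 0\<close> by blast
    \<comment> \<open>The unit u is 1 or -1 and l is odd, so u is its own l-th power and can be
      moved into the base.\<close>
    have "u ^ l = u" using units[OF u(1,3)] \<open>odd l\<close> by auto
    define \<gamma> where "\<gamma> = \<beta> * u"
    have \<gamma>: "\<gamma> \<in> ?O" "\<gamma> ^ l = \<alpha>"
      using \<open>\<beta> \<in> ?O\<close> u \<open>u ^ l = u\<close> by (auto simp: \<gamma>_def power_mult_distrib integer_mult)
    obtain a :: int where a: "2 * Re \<gamma> = of_int a"
      using integer_trace[OF \<gamma>(1)] by (auto elim: Ints_cases)
    \<comment> \<open>The norm of \<gamma> and U^k are nonnegative reals with the same l-th power,
      hence equal.\<close>
    have "((cmod \<gamma>)\<^sup>2) ^ l = (cmod (\<gamma> ^ l))\<^sup>2"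
      by (simp only: norm_power power_mult[symmetric] mult.commute)
    also have "\<dots> = (of_int U ^ k) ^ l" by (simp only: \<gamma>(2) norm l power_mult)
    finally have v: "(cmod \<gamma>)\<^sup>2 = of_int (U ^ k)"
      using U \<open>l \<ge> 3\<close> by (simp add: power_eq_iff_eq_base)
    have "of_int (lucas a (U ^ k) l) = (of_int 1 :: real)"
      unfolding lucas_eq_trace_power[OF a v, symmetric] \<gamma>(2) by (simp add: Re)
    hence "lucas a (U ^ k) l = 1" by (simp only: of_int_eq_iff)
    moreover have "U ^ k \<ge> U" using \<open>k > 0\<close> U by (intro self_le_power) auto
    ultimately have "U ^ k dvd int l" using \<open>odd l\<close> \<open>l \<ge> 3\<close> U by (intro lucas_eq_1_imp_dvd) auto
    hence "U ^ k \<le> int l" using \<open>l \<ge> 3\<close> by (intro zdvd_imp_le) auto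
    also have "int l \<le> int n" using \<open>k > 0\<close> unfolding l of_nat_le_iff by simp
    finally show False using \<open>U ^ k \<ge> U\<close> U by simp
  qed
  hence "C.ord ?c = n" using l by (simp add: k_def)
  thus ?thesis
    using C.ord_dvd_group_order[OF c] by (simp add: class_number_def ideal_class_group_def)
qed

end

section \<open>Infinitely many pairs\<close>

text \<open>Descent: \<open>y\<close> may be taken even and smaller than \<open>m\<close>, and then the cofactor of \<open>m\<close> in
  \<open>y\<^sup>2 + 1\<close> is smaller than \<open>m\<close> and again congruent to 3 modulo 4.\<close>

lemma not_dvd_square_plus_1:
  fixes m y :: nat
  assumes "m mod 4 = 3"
  shows "\<not> m dvd y\<^sup>2 + 1"
  using assms
proof (induction m arbitrary: y rule: less_induct)
  case (less m)
  show ?case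
  proof
    assume dvd: "m dvd y\<^sup>2 + 1"
    have m: "m \<ge> 3" "odd m" using less.prems by presburger+
    define r where "r = y mod m"
    have r: "r < m" using m by (simp add: r_def)
    have "(r\<^sup>2 + 1) mod m = (y\<^sup>2 + 1) mod m" unfolding r_def by (metis mod_add_left_eq power_mod)
    hence r_dvd: "m dvd r\<^sup>2 + 1" using dvd by (simp only: dvd_eq_mod_eq_0)
    obtain z where z: "z < m" "even z" "m dvd z\<^sup>2 + 1"
    proof (cases "even r")
      case True
      thus ?thesis using that r r_dvd by blast
    next
      case False
      \<comment> \<open>An odd r is replaced by m - r, which is even because m is odd. Adding m (q -
        r) = q^2 - r^2 passes from r^2 + 1 to q^2 + 1.\<close>
      obtain q where q: "m = r + q" "q > 0" using r by (metis less_imp_add_positive)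
      have "int m dvd int (r\<^sup>2 + 1) + int m * (int q - int r)"
        using r_dvd by (intro dvd_add) (simp_all only: of_nat_dvd_iff dvd_triv_left)
      also have "\<dots> = int (q\<^sup>2 + 1)"
        unfolding q(1) by (simp add: power2_eq_square algebra_simps)
      finally have "m dvd q\<^sup>2 + 1" by (simp only: of_nat_dvd_iff)
      moreover have "r > 0" using False by (rule odd_pos)
      ultimately show ?thesis using that[of q] m(2) q(1) False by simp
    qed
    obtain k where k: "z\<^sup>2 + 1 = m * k" using z(3) by (elim dvdE)
    \<comment> \<open>Since z is even, m k = z^2 + 1 is 1 modulo 4, and 3 is its own inverse modulo
      4.\<close>
    have "k mod 4 = 3"
    proof -
      obtain q where q: "z = 2 * q" using z(2) by (elim evenE)
      have "(m * k) mod 4 = 1" unfolding k[symmetric] q by (simp add: power2_eq_square)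
      hence "((m mod 4) * (k mod 4)) mod 4 = 1" by (simp add: mod_simps)
      hence "(3 * (k mod 4)) mod 4 = 1" by (simp only: less.prems)
      moreover have "k mod 4 = 0 \<or> k mod 4 = 1 \<or> k mod 4 = 2 \<or> k mod 4 = 3" by presburger
      ultimately show ?thesis by auto
    qed
    moreover have "k < m"
    proof -
      have "z\<^sup>2 + 1 \<le> (m - 1) * (m - 1) + 1"
        unfolding power2_eq_square using z(1) by (intro add_right_mono mult_le_mono) auto
      also have "\<dots> < m * m" using m by (cases m) auto
      finally have "m * k < m * m" by (simp only: k)
      thus ?thesis by simp
    qed
    moreover have "k dvd z\<^sup>2 + 1" by (simp only: k dvd_triv_right)
    ultimately show False using less.IH by blast
  qed
qed

section \<open>Units and the choice of parameters\<close>

text \<open>With t the trace of u and Im u = b sqrt D, the number k = 2 b D is an integer with k^2 =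
  (4 - t^2) D, so |t| \<le> 2. For t = 0 (primitive fourth roots of unity) D would be a square, yet
  it is 3 modulo 4. For |t| = 1 (primitive third and sixth roots) 3 D would be a square and 3 would
  divide D. For |t| = 2 the imaginary part vanishes.\<close>

lemma units_rat_sqrt_field:
  fixes D :: int
  assumes D: "D mod 4 = 3" "\<not> 3 dvd D" "D > 0"
    and u: "u \<in> ring_of_integers (rat_sqrt_field (- D))" "cmod u = 1"
  shows "u = 1 \<or> u = -1"
proof -
  have neg: "- D < 0" using D by simp
  interpret imaginary_field "rat_sqrt_field (- D)" using neg by (rule imaginary_field_rat_sqrt_field)
  obtain b where b: "b \<in> \<rat>" "Im u = b * sqrt (of_int D)"
    using rat_sqrt_fieldE[OF neg integer_in[OF u(1)]] by (metis minus_minus)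
  obtain t :: int where t: "2 * Re u = of_int t" using integer_trace[OF u(1)] by (auto elim: Ints_cases)
  have norm: "(Re u)\<^sup>2 + (Im u)\<^sup>2 = 1" using u(2) by (metis cmod_power2 one_power2)
  hence "4 * (Im u)\<^sup>2 = 4 - (2 * Re u)\<^sup>2" by (simp add: power_mult_distrib)
  hence eq: "4 * (b\<^sup>2 * of_int D) = of_int (4 - t\<^sup>2)"
    using D(3) by (simp add: t b power_mult_distrib)
  have sq: "(2 * b * of_int D)\<^sup>2 = of_int ((4 - t\<^sup>2) * D)"
    unfolding of_int_mult eq[symmetric] by (simp add: power2_eq_square)
  have "2 * b * of_int D \<in> \<rat>" using b(1) by simp
  hence "2 * b * of_int D \<in> \<int>" by (rule rat_sqr_int_imp_int) (simp only: sq Ints_of_int)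
  then obtain k :: int where "2 * b * of_int D = of_int k" by (auto elim: Ints_cases)
  hence k: "k\<^sup>2 = (4 - t\<^sup>2) * D" using sq by (simp only: of_int_power[symmetric] of_int_eq_iff)
  have "t\<^sup>2 \<le> 4"
  proof -
    have "0 \<le> k\<^sup>2" by simp
    hence "0 \<le> 4 - t\<^sup>2" unfolding k using D(3) by (simp add: zero_le_mult_iff)
    thus ?thesis by simp
  qed
  hence "\<bar>t\<bar> \<le> 2" using abs_le_square_iff[of t 2] by simp
  hence "t = 0 \<or> \<bar>t\<bar> = 1 \<or> \<bar>t\<bar> = 2" by presburger
  thus ?thesis
  proof (elim disjE)
    assume "t = 0"
    hence "k\<^sup>2 = 4 * D" using k by simp
    hence "even (k\<^sup>2)" by simp
    then obtain j where j: "k = 2 * j" by (auto elim: evenE)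
    hence "j\<^sup>2 = D" using \<open>k\<^sup>2 = 4 * D\<close> by (simp add: power_mult_distrib)
    moreover have "j mod 4 = 0 \<or> j mod 4 = 1 \<or> j mod 4 = 2 \<or> j mod 4 = 3" by presburger
    hence "j\<^sup>2 mod 4 = 0 \<or> j\<^sup>2 mod 4 = 1" by (auto simp: power2_eq_square mod_mult_eq[of j 4 j, symmetric])
    ultimately show ?thesis using D(1) by simp
  next
    assume "\<bar>t\<bar> = 1"
    hence "t\<^sup>2 = 1" by (metis power2_abs one_power2)
    hence k3: "k\<^sup>2 = 3 * D" using k by simp
    hence "3 dvd k * k" by (simp add: power2_eq_square)
    moreover have "prime (3::int)" by simp
    ultimately have "3 dvd k" by (metis prime_dvd_mult_iff)
    then obtain j where "k = 3 * j" by (elim dvdE)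
    hence "D = 3 * j\<^sup>2" using k3 by (simp add: power_mult_distrib)
    thus ?thesis using D(2) by simp
  next
    assume "\<bar>t\<bar> = 2"
    hence t2: "t = 2 \<or> t = -2" by presburger
    hence "(Im u)\<^sup>2 = 0" using eq b D(3) by (auto simp: power_mult_distrib)
    thus ?thesis using t t2 by (auto simp: complex_eq_iff)
  qed
qed

text \<open>D = 4 U^n - 1 is 3 modulo 4 by its shape; together with \<open>not3\<close> this leaves
  only the units 1 and -1, as \<open>dvd_class_number\<close> requires.\<close>

lemma dvd_class_number_rat_sqrt_field:
  fixes U :: int and n :: nat
  assumes n: "odd n" and U: "U > int n" "U \<ge> 3" and not3: "\<not> 3 dvd 4 * U ^ n - 1"
  shows "n dvd class_number (rat_sqrt_field (1 - 4 * U ^ n))"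
proof -
  define D where "D = 4 * U ^ n - 1"
  have "U ^ n \<ge> 1" using U by simp
  hence D: "D > 0" "D mod 4 = 3" unfolding D_def by presburger+
  have neg: "- D < 0" using D by simp
  interpret imaginary_field "rat_sqrt_field (- D)" using neg by (rule imaginary_field_rat_sqrt_field)
  define \<alpha> where "\<alpha> = 1 / 2 + 1 / 2 * csqrt (of_int (- D))"
  have s: "Re (csqrt (of_int (- D))) = 0" "Im (csqrt (of_int (- D))) = sqrt (of_int D)"
    unfolding csqrt_of_neg_int[OF neg] by simp_all
  have "n dvd class_number (rat_sqrt_field (- D))"
  proof (rule dvd_class_number)
    show "\<alpha> \<in> rat_sqrt_field (- D)" unfolding \<alpha>_def using neg by (intro rat_sqrt_fieldI) auto
    have Re: "Re \<alpha> = 1 / 2" and Im: "Im \<alpha> = sqrt (of_int D) / 2"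
      unfolding \<alpha>_def using s by (simp_all del: csqrt.sel of_int_minus)
    show "Re \<alpha> = 1 / 2" by (rule Re)
    show "(cmod \<alpha>)\<^sup>2 = of_int U ^ n"
      unfolding cmod_power2 Re Im using D(1) by (simp add: power_divide) (simp add: D_def field_simps)
    show "u = 1 \<or> u = - 1" if "u \<in> ring_of_integers (rat_sqrt_field (- D))" "cmod u = 1" for u
      using units_rat_sqrt_field D not3 that by (auto simp: D_def)
  qed (use n U in auto)
  thus ?thesis by (simp add: D_def)
qed

text \<open>Odd powers of -1 are -1 modulo 3. For U = 4 w^n - 1 with 3 dividing w, this shows that 4
  U^n - 1 is 1 modulo 3, which is the condition \<open>not3\<close> for the second field.\<close>

lemma three_dvd_power_plus_1:
  fixes U :: int
  assumes "3 dvd U + 1"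
  shows "3 dvd U ^ Suc (2 * m) + 1"
proof (induction m)
  case (Suc m)
  have "U ^ Suc (2 * Suc m) + 1 = U * U * (U ^ Suc (2 * m) + 1) - (U + 1) * (U - 1)"
    by (simp add: algebra_simps)
  thus ?case using Suc assms by (metis dvd_diff dvd_mult dvd_mult2)
qed (use assms in simp)

text \<open>The factor 6 makes all values even, for the argument modulo 4, and divisible by 3, which keeps
  the cube roots of unity out of the fields.\<close>

fun param_seq :: "nat \<Rightarrow> nat \<Rightarrow> int" where
  "param_seq n 0 = 6 * (int n + 1)"
| "param_seq n (Suc i) = param_seq n i * (2 * param_seq n i ^ n - 1)"

text \<open>The start value is chosen so that w > n and w \<ge> 3 hold throughout; each step
  multiplies by a factor of at least 1.\<close>

lemma param_seq_ge: "param_seq n i \<ge> 6 * (int n + 1)"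
proof (induction i)
  case (Suc i)
  hence "param_seq n i ^ n \<ge> 1" by simp
  hence "1 \<le> 2 * param_seq n i ^ n - 1" by linarith
  hence "param_seq n i * 1 \<le> param_seq n i * (2 * param_seq n i ^ n - 1)" using Suc by (intro mult_left_mono) auto
  thus ?case using Suc unfolding param_seq.simps(2) mult_1_right by linarith
qed simp

lemma six_dvd_param_seq: "6 dvd param_seq n i"
  by (induction i) auto

text \<open>The factor enters at the step from i to i + 1, and each value divides all later
  ones.\<close>

lemma dvd_param_seq:
  assumes "i < j"
  shows "2 * param_seq n i ^ n - 1 dvd param_seq n j"
proof -
  have "param_seq n (Suc i) dvd param_seq n (Suc i + k)" for k
  proof (induction k)
    case (Suc k)
    thus ?case unfolding add_Suc_right param_seq.simps(2)[of n "Suc i + k"] by (rule dvd_mult2)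
  qed simp
  from this[of "j - Suc i"] have "param_seq n (Suc i) dvd param_seq n j"
    using assms by (simp del: param_seq.simps(2))
  thus ?thesis by (metis param_seq.simps(2) dvd_mult_right)
qed

lemma rat_sqrt_field_param_seq_distinct:
  assumes "n > 0" "i < j"
  shows "rat_sqrt_field (1 - 4 * param_seq n i ^ n) \<noteq> rat_sqrt_field (1 - 4 * param_seq n j ^ n)"
proof
  assume eq: "rat_sqrt_field (1 - 4 * param_seq n i ^ n) = rat_sqrt_field (1 - 4 * param_seq n j ^ n)"
  have pos: "param_seq n i ^ n \<ge> 1" for i using param_seq_ge[of n i] by simp
  define m where "m = 2 * param_seq n i ^ n - 1"
  have "1 - 4 * param_seq n i ^ n < 0" for i using pos[of i] by simp
  then obtain k where k: "(1 - 4 * param_seq n i ^ n) * (1 - 4 * param_seq n j ^ n) = k\<^sup>2"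
    using rat_sqrt_field_eq_imp_square[OF _ _ eq] by blast
  have "m dvd param_seq n j ^ n"
    using dvd_param_seq[OF assms(2), of n] assms(1) by (simp add: m_def dvd_power_le dvd_trans[OF _ dvd_power])
  then obtain q where q: "param_seq n j ^ n = m * q" by (elim dvdE)
  \<comment> \<open>By the choice of m, the first factor 1 - 4 w^n is -1 - 2 m. The second is 1
    modulo m, since m divides \<open>param_seq n j ^ n\<close>.\<close>
  have "k\<^sup>2 + 1 = (- 1 - 2 * m) * (1 - 4 * (m * q)) + 1"
    unfolding k[symmetric] q by (simp add: m_def)
  also have "\<dots> = m * (4 * q + 8 * (m * q) - 2)" by (simp add: algebra_simps)
  finally have "m dvd k\<^sup>2 + 1" by simp
  \<comment> \<open>Evenness of \<open>param_seq n i ^ n\<close> gives m the form 4 p - 1, hence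
    residue 3 modulo 4.\<close>
  moreover have "2 dvd param_seq n i" using six_dvd_param_seq[of n i] by (metis dvd_trans even_numeral)
  hence "2 dvd param_seq n i ^ n" using assms(1) by simp
  then obtain p where "param_seq n i ^ n = 2 * p" by (elim dvdE)
  hence "m = 4 * p - 1" "p \<ge> 1" using pos[of i] by (simp_all add: m_def)
  hence m4: "m mod 4 = 3" "m > 0" by presburger+
  ultimately have "int (nat m) dvd int ((nat \<bar>k\<bar>)\<^sup>2 + 1)" by (simp add: add.commute)
  hence "nat m dvd (nat \<bar>k\<bar>)\<^sup>2 + 1" by (simp only: of_nat_dvd_iff)
  moreover have "nat m mod 4 = 3" using m4 nat_mod_distrib[of m 4] by simp
  ultimately show False using not_dvd_square_plus_1 by blast
qed

theorem theorem5p1: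
  fixes n :: nat
  assumes "odd n" and "n \<ge> 3"
  shows "infinite {(K, L).
           imaginary_quadratic_field K \<and> imaginary_quadratic_field L \<and>
           (\<exists>d::int. K = rat_sqrt_field d \<and> L = rat_sqrt_field (d + 1)) \<and>
           n dvd class_number K \<and> n dvd class_number L}"
    (is "infinite ?S")
proof -
  define F where "F = (\<lambda>w. rat_sqrt_field (1 - 4 * w ^ n))"
  define f where "f = (\<lambda>i. (F (param_seq n i), F (4 * param_seq n i ^ n - 1)))"
  obtain m where m: "n = Suc (2 * m)" using assms(1) by (auto elim: oddE)
  have "f i \<in> ?S" for i
  proof -
    define w where "w = param_seq n i"
    define U where "U = 4 * w ^ n - 1"
    have w: "w > int n" "w \<ge> 3" "3 dvd w"
      using param_seq_ge[of n i] six_dvd_param_seq[of n i] by (auto simp: w_def intro: dvd_trans[of 3 6])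
    have "w ^ n \<ge> w" using w assms by (intro self_le_power) auto
    hence U: "U > int n" "U \<ge> 3" using w by (auto simp: U_def)
    have "3 dvd w ^ n" using w(3) m by simp
    hence w3: "\<not> 3 dvd 4 * w ^ n - 1" "3 dvd U + 1" unfolding U_def by presburger+
    have "3 dvd U ^ n + 1" unfolding m using w3(2) by (rule three_dvd_power_plus_1)
    hence U3: "\<not> 3 dvd 4 * U ^ n - 1" by presburger
    \<comment> \<open>As n = 2 m + 1, splitting off the square of 2 U^m leaves a single factor U;
      positivity of U meets the sign conditions on both factors.\<close>
    have "rat_sqrt_field (- 4 * U ^ n) = rat_sqrt_field ((2 * U ^ m)\<^sup>2 * (- U))"
      by (simp add: m power_mult_distrib power_mult[symmetric] mult_ac)
    also have "\<dots> = rat_sqrt_field (- U)" using U by (intro rat_sqrt_field_square_mult) auto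
    also have "- U = 1 - 4 * w ^ n" by (simp add: U_def)
    finally have "F w = rat_sqrt_field (- 4 * U ^ n)" by (simp add: F_def)
    moreover have "F U = rat_sqrt_field (- 4 * U ^ n + 1)" by (simp add: F_def add.commute)
    moreover have "imaginary_quadratic_field (F v)" if "v \<ge> 3" for v
    proof -
      have "v ^ n \<ge> 1" using that by simp
      thus ?thesis unfolding F_def by (intro imaginary_quadratic_field_rat_sqrt_field) simp
    qed
    moreover have "n dvd class_number (F w)" "n dvd class_number (F U)"
      unfolding F_def using assms w U w3 U3 by (auto intro!: dvd_class_number_rat_sqrt_field)
    ultimately have "(F w, F U) \<in> ?S" using w U by blast
    thus ?thesis by (simp add: f_def w_def U_def)
  qed
  \<comment> \<open>The first components alone already separate the pairs.\<close>
  moreover have "inj f"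
  proof (rule linorder_injI)
    fix i j :: nat assume "i < j"
    thus "f i \<noteq> f j"
      using rat_sqrt_field_param_seq_distinct[of n i j] assms by (simp add: f_def F_def)
  qed
  ultimately show ?thesis
    by (meson image_subsetI infinite_super range_inj_infinite)
qed

end
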